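(* Let $L$ be a finite-dimensional Lie algebra over the finite field $\mathbb{F}_q$ with Frattini ideal $\phi(L)$, and let $n=\dim(L/\phi(L))$. If the number of vertices of the comaximal graph $\Gamma(L/\phi(L))$ is $\sum_{k=1}^{n-1}\binom{n}{k}_q$, then $L$ is supersolvable. Moreover, either $L$ is nilpotent, or $L^2=N(L)$, the nilradical of $L$, and $L^2$ has codimension one in $L$.
   Context: For a finite-dimensional Lie algebra $L$, the comaximal graph $\Gamma(L)$ is the simple undirected graph whose vertices are the proper nonzero Lie subalgebras of $L$, two distinct vertices being adjacent iff together they generate $L$. The Frattini subalgebra $F(L)$ is the intersection of all maximal subalgebras of $L$ (and $F(L)=L$ if there are none); the Frattini ideal $\phi(L)$ is the largest ideal of $L$ contained in $F(L)$. $\binom{n}{k}_q$ is the Gaussian binomial coefficient (the number of $k$-dimensional subspaces of $\mathbb{F}_q^n$). $L^2=[L,L]$; the nilradical $N(L)$ is the largest nilpotent ideal of $L$. $L$ is supersolvable if it has a chain $0=L_0\subset L_1\subset\cdots\subset L_m=L$ of ideals of $L$ with $\dim L_i=i$. *)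

theory Defs
  imports
    Complex_Main
    "HOL-Algebra.QuotRing"
    "Jordan_Normal_Form.Missing_VectorSpace"
    "Graph_Theory.Pair_Digraph"
begin

section \<open>Lie algebras\<close>

text \<open>
  A Lie algebra is a vector space with a bracket, so its record extends that of a module.
  The fields \<open>mult\<close> and \<open>one\<close> inherited from rings carry no meaning, as for modules.
\<close>

record ('a, 'b) lie_algebra = "('a, 'b) module" +
  bracket :: "['b, 'b] \<Rightarrow> 'b"

locale lie_algebra = vectorspace K L
  for K (structure) and L :: "('a, 'b, 'm) lie_algebra_scheme" (structure) +
  assumes bracket_closed [simp, intro]:
      "\<lbrakk>x \<in> carrier L; y \<in> carrier L\<rbrakk> \<Longrightarrow> bracket L x y \<in> carrier L"
    and bracket_add_left:
      "\<lbrakk>x \<in> carrier L; y \<in> carrier L; z \<in> carrier L\<rbrakk> \<Longrightarrow>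
        bracket L (x \<oplus>\<^bsub>L\<^esub> y) z = bracket L x z \<oplus>\<^bsub>L\<^esub> bracket L y z"
    and bracket_add_right:
      "\<lbrakk>x \<in> carrier L; y \<in> carrier L; z \<in> carrier L\<rbrakk> \<Longrightarrow>
        bracket L x (y \<oplus>\<^bsub>L\<^esub> z) = bracket L x y \<oplus>\<^bsub>L\<^esub> bracket L x z"
    and bracket_smult_left:
      "\<lbrakk>a \<in> carrier K; x \<in> carrier L; y \<in> carrier L\<rbrakk> \<Longrightarrow>
        bracket L (a \<odot>\<^bsub>L\<^esub> x) y = a \<odot>\<^bsub>L\<^esub> bracket L x y"
    and bracket_smult_right:
      "\<lbrakk>a \<in> carrier K; x \<in> carrier L; y \<in> carrier L\<rbrakk> \<Longrightarrow>
        bracket L x (a \<odot>\<^bsub>L\<^esub> y) = a \<odot>\<^bsub>L\<^esub> bracket L x y"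
    and bracket_self [simp]:
      "x \<in> carrier L \<Longrightarrow> bracket L x x = \<zero>\<^bsub>L\<^esub>"
    and jacobi:
      "\<lbrakk>x \<in> carrier L; y \<in> carrier L; z \<in> carrier L\<rbrakk> \<Longrightarrow>
        bracket L x (bracket L y z) \<oplus>\<^bsub>L\<^esub> bracket L y (bracket L z x)
          \<oplus>\<^bsub>L\<^esub> bracket L z (bracket L x y) = \<zero>\<^bsub>L\<^esub>"

definition lie_subalgebra ::
  "('a, 'r) ring_scheme \<Rightarrow> ('a, 'b, 'm) lie_algebra_scheme \<Rightarrow> 'b set \<Rightarrow> bool" where
  "lie_subalgebra K L S \<longleftrightarrow>
     VectorSpace.subspace K S L \<and> (\<forall>x\<in>S. \<forall>y\<in>S. bracket L x y \<in> S)"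

definition lie_ideal ::
  "('a, 'r) ring_scheme \<Rightarrow> ('a, 'b, 'm) lie_algebra_scheme \<Rightarrow> 'b set \<Rightarrow> bool" where
  "lie_ideal K L I \<longleftrightarrow>
     VectorSpace.subspace K I L \<and> (\<forall>x\<in>carrier L. \<forall>y\<in>I. bracket L x y \<in> I)"

definition lie_generated ::
  "('a, 'r) ring_scheme \<Rightarrow> ('a, 'b, 'm) lie_algebra_scheme \<Rightarrow> 'b set \<Rightarrow> 'b set" where
  "lie_generated K L X = \<Inter>{S. lie_subalgebra K L S \<and> X \<subseteq> S}"

text \<open>The quotient by an ideal, on additive cosets, in the style of \<^const>\<open>FactRing\<close>.\<close>

definition lie_quotient ::
  "('a, 'b, 'm) lie_algebra_scheme \<Rightarrow> 'b set \<Rightarrow> ('a, 'b set) lie_algebra" where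
  "lie_quotient L I =
     \<lparr>carrier = a_rcosets\<^bsub>L\<^esub> I, monoid.mult = rcoset_mult L I, one = I +>\<^bsub>L\<^esub> \<one>\<^bsub>L\<^esub>,
      zero = I, add = set_add L,
      smult = (\<lambda>a X. \<Union>x\<in>X. I +>\<^bsub>L\<^esub> (a \<odot>\<^bsub>L\<^esub> x)),
      bracket = (\<lambda>X Y. \<Union>x\<in>X. \<Union>y\<in>Y. I +>\<^bsub>L\<^esub> bracket L x y)\<rparr>"

context lie_algebra
begin

lemma lie_ideal_abelian_subgroup:
  assumes "lie_ideal K L I"
  shows "abelian_subgroup I L"
proof -
  have sm: "LinearCombinations.submodule K I L"
    using assms by (simp add: lie_ideal_def VectorSpace.subspace_def)
  have "Module.submodule I K L"
    by (rule module_incl_imp_submodule[OF LinearCombinations.submodule.subset[OF sm]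
          submodule_is_module[OF sm]])
  then have "subgroup I (add_monoid L)"
    by (rule Module.submodule.axioms(1))
  then show ?thesis
    by (meson abelian_subgroupI3 additive_subgroup.intro M.abelian_group_axioms)
qed

lemma lie_quotient_smult_rcos:
  assumes I: "lie_ideal K L I" and a: "a \<in> carrier K" and x: "x \<in> carrier L"
  shows "a \<odot>\<^bsub>lie_quotient L I\<^esub> (I +>\<^bsub>L\<^esub> x) = I +>\<^bsub>L\<^esub> (a \<odot>\<^bsub>L\<^esub> x)"
proof -
  interpret I: abelian_subgroup I L by (rule lie_ideal_abelian_subgroup[OF I])
  have sm: "LinearCombinations.submodule K I L"
    using I by (simp add: lie_ideal_def VectorSpace.subspace_def)
  have *: "I +>\<^bsub>L\<^esub> (a \<odot>\<^bsub>L\<^esub> x') = I +>\<^bsub>L\<^esub> (a \<odot>\<^bsub>L\<^esub> x)" if "x' \<in> I +>\<^bsub>L\<^esub> x" for x'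
  proof -
    obtain h where h: "h \<in> I" "x' = h \<oplus>\<^bsub>L\<^esub> x"
      using \<open>x' \<in> I +>\<^bsub>L\<^esub> x\<close> unfolding a_r_coset_def' by blast
    have hL: "h \<in> carrier L" using h by (simp add: I.a_Hcarr)
    have "a \<odot>\<^bsub>L\<^esub> x' = a \<odot>\<^bsub>L\<^esub> h \<oplus>\<^bsub>L\<^esub> a \<odot>\<^bsub>L\<^esub> x" using a x hL h by (simp add: smult_r_distr)
    moreover have "a \<odot>\<^bsub>L\<^esub> h \<in> I" using submodule.smult_closed[OF sm] a h by auto
    ultimately have "a \<odot>\<^bsub>L\<^esub> x' \<in> I +>\<^bsub>L\<^esub> (a \<odot>\<^bsub>L\<^esub> x)" unfolding a_r_coset_def' by auto
    then show ?thesis using I.a_repr_independence' a x by simp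
  qed
  have ne: "I +>\<^bsub>L\<^esub> x \<noteq> {}"
    using I.a_rcos_self[of x] x by auto
  have "a \<odot>\<^bsub>lie_quotient L I\<^esub> (I +>\<^bsub>L\<^esub> x) = (\<Union>x'\<in>I +>\<^bsub>L\<^esub> x. I +>\<^bsub>L\<^esub> (a \<odot>\<^bsub>L\<^esub> x'))"
    by (simp add: lie_quotient_def)
  also have "\<dots> = (\<Union>x'\<in>I +>\<^bsub>L\<^esub> x. I +>\<^bsub>L\<^esub> (a \<odot>\<^bsub>L\<^esub> x))"
    by (intro SUP_cong refl *)
  also have "\<dots> = I +>\<^bsub>L\<^esub> (a \<odot>\<^bsub>L\<^esub> x)"
    by (simp only: UN_constant ne if_False)
  finally show ?thesis .
qed

lemma bracket_antisym:
  assumes "x \<in> carrier L" "y \<in> carrier L"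
  shows "bracket L x y = \<ominus>\<^bsub>L\<^esub> bracket L y x"
proof -
  have "\<zero>\<^bsub>L\<^esub> = bracket L (x \<oplus>\<^bsub>L\<^esub> y) (x \<oplus>\<^bsub>L\<^esub> y)" using assms by simp
  also have "\<dots> = bracket L x (x \<oplus>\<^bsub>L\<^esub> y) \<oplus>\<^bsub>L\<^esub> bracket L y (x \<oplus>\<^bsub>L\<^esub> y)"
    using assms by (intro bracket_add_left) auto
  also have "\<dots> = bracket L x y \<oplus>\<^bsub>L\<^esub> bracket L y x"
    using assms by (simp add: bracket_add_right)
  finally show ?thesis using assms by (metis M.minus_equality bracket_closed)
qed

lemma lie_quotient_bracket_rcos:
  assumes I: "lie_ideal K L I" and x: "x \<in> carrier L" and y: "y \<in> carrier L"
  shows "bracket (lie_quotient L I) (I +>\<^bsub>L\<^esub> x) (I +>\<^bsub>L\<^esub> y) = I +>\<^bsub>L\<^esub> bracket L x y"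
proof -
  interpret I: abelian_subgroup I L by (rule lie_ideal_abelian_subgroup[OF I])
  have il: "bracket L u h \<in> I" if "u \<in> carrier L" "h \<in> I" for u h
    using I that by (simp add: lie_ideal_def)
  have ir: "bracket L h u \<in> I" if "u \<in> carrier L" "h \<in> I" for u h
    using il[OF that] bracket_antisym[of h u] that I.a_inv_closed by (simp add: I.a_Hcarr)
  have *: "I +>\<^bsub>L\<^esub> bracket L x' y' = I +>\<^bsub>L\<^esub> bracket L x y"
    if x': "x' \<in> I +>\<^bsub>L\<^esub> x" and y': "y' \<in> I +>\<^bsub>L\<^esub> y" for x' y'
  proof -
    obtain h k where h: "h \<in> I" "x' = h \<oplus>\<^bsub>L\<^esub> x" "k \<in> I" "y' = k \<oplus>\<^bsub>L\<^esub> y"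
      using x' y' unfolding a_r_coset_def' by blast
    have hL: "h \<in> carrier L" "k \<in> carrier L" using h by (simp_all add: I.a_Hcarr)
    have "bracket L x' y' = (bracket L h (k \<oplus>\<^bsub>L\<^esub> y) \<oplus>\<^bsub>L\<^esub> bracket L x k) \<oplus>\<^bsub>L\<^esub> bracket L x y"
      using x y hL h by (simp add: bracket_add_right bracket_add_left M.a_ac)
    moreover have "bracket L h (k \<oplus>\<^bsub>L\<^esub> y) \<oplus>\<^bsub>L\<^esub> bracket L x k \<in> I"
      using il ir h hL x y by (simp add: I.a_closed)
    ultimately have "bracket L x' y' \<in> I +>\<^bsub>L\<^esub> bracket L x y" unfolding a_r_coset_def' by auto
    then show ?thesis using I.a_repr_independence' x y by simp
  qed
  have ne: "I +>\<^bsub>L\<^esub> x \<noteq> {}" "I +>\<^bsub>L\<^esub> y \<noteq> {}"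
    using I.a_rcos_self[of x] I.a_rcos_self[of y] x y by auto
  have "bracket (lie_quotient L I) (I +>\<^bsub>L\<^esub> x) (I +>\<^bsub>L\<^esub> y) =
      (\<Union>x'\<in>I +>\<^bsub>L\<^esub> x. \<Union>y'\<in>I +>\<^bsub>L\<^esub> y. I +>\<^bsub>L\<^esub> bracket L x' y')"
    by (simp add: lie_quotient_def)
  also have "\<dots> = (\<Union>x'\<in>I +>\<^bsub>L\<^esub> x. \<Union>y'\<in>I +>\<^bsub>L\<^esub> y. I +>\<^bsub>L\<^esub> bracket L x y)"
    by (intro SUP_cong refl *)
  also have "\<dots> = I +>\<^bsub>L\<^esub> bracket L x y"
    by (simp only: UN_constant ne if_False)
  finally show ?thesis .
qed

lemma lie_quotient_lie_algebra:
  assumes I: "lie_ideal K L I"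
  shows "lie_algebra K (lie_quotient L I)"
proof -
  let ?Q = "lie_quotient L I"
  interpret I: abelian_subgroup I L by (rule lie_ideal_abelian_subgroup[OF I])
  have car: "carrier ?Q = {I +>\<^bsub>L\<^esub> x | x. x \<in> carrier L}"
    by (auto simp: lie_quotient_def A_RCOSETS_def')
  have zero: "\<zero>\<^bsub>?Q\<^esub> = I +>\<^bsub>L\<^esub> \<zero>\<^bsub>L\<^esub>" by (simp add: lie_quotient_def I.a_subset)
  have add: "(I +>\<^bsub>L\<^esub> x) \<oplus>\<^bsub>?Q\<^esub> (I +>\<^bsub>L\<^esub> y) = I +>\<^bsub>L\<^esub> (x \<oplus>\<^bsub>L\<^esub> y)"
    if "x \<in> carrier L" "y \<in> carrier L" for x y
    using that by (simp add: lie_quotient_def I.a_rcos_sum)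
  note s = lie_quotient_smult_rcos[OF I] and b = lie_quotient_bracket_rcos[OF I]
  have field: "field K" by (rule local.field.field_axioms)
  have "vectorspace K ?Q"
  proof (rule vs_criteria[OF field])
    show "\<forall>v\<in>carrier ?Q. \<exists>w\<in>carrier ?Q. v \<oplus>\<^bsub>?Q\<^esub> w = \<zero>\<^bsub>?Q\<^esub>"
    proof
      fix v assume "v \<in> carrier ?Q"
      then obtain x where x: "x \<in> carrier L" "v = I +>\<^bsub>L\<^esub> x" by (auto simp: car)
      have "v \<oplus>\<^bsub>?Q\<^esub> (I +>\<^bsub>L\<^esub> (\<ominus>\<^bsub>L\<^esub> x)) = \<zero>\<^bsub>?Q\<^esub>"
        using x by (simp add: add zero M.r_neg)
      moreover have "I +>\<^bsub>L\<^esub> (\<ominus>\<^bsub>L\<^esub> x) \<in> carrier ?Q"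
        using x unfolding car by blast
      ultimately show "\<exists>w\<in>carrier ?Q. v \<oplus>\<^bsub>?Q\<^esub> w = \<zero>\<^bsub>?Q\<^esub>" by blast
    qed
  qed (auto simp: car zero add s M.a_ac smult_assoc1 smult_l_distr smult_r_distr)
  moreover have "lie_algebra_axioms K ?Q"
  proof
    fix X Y assume "X \<in> carrier ?Q" "Y \<in> carrier ?Q"
    then obtain x y where "x \<in> carrier L" "y \<in> carrier L" "X = I +>\<^bsub>L\<^esub> x" "Y = I +>\<^bsub>L\<^esub> y"
      by (auto simp: car)
    moreover from this have "I +>\<^bsub>L\<^esub> bracket L x y \<in> carrier ?Q"
      unfolding car using bracket_closed by blast
    ultimately show "bracket ?Q X Y \<in> carrier ?Q"
      by (simp add: b)
  qed (auto simp: car zero add s b bracket_add_left bracket_add_right bracket_smult_left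
      bracket_smult_right jacobi)
  ultimately show ?thesis
    by (rule lie_algebra.intro)
qed

end


section \<open>The comaximal graph\<close>

text \<open>An undirected edge is represented by the two arcs joining its end points.\<close>

definition comaximal_graph ::
  "('a, 'r) ring_scheme \<Rightarrow> ('a, 'b, 'm) lie_algebra_scheme \<Rightarrow> 'b set pair_pre_digraph" where
  "comaximal_graph K L =
     (let V = {S. lie_subalgebra K L S \<and> S \<noteq> {\<zero>\<^bsub>L\<^esub>} \<and> S \<noteq> carrier L}
      in \<lparr>pverts = V,
          parcs = {(S, T). S \<in> V \<and> T \<in> V \<and> S \<noteq> T \<and> lie_generated K L (S \<union> T) = carrier L}\<rparr>)"

lemma comaximal_graph_arcs:
  "(S, T) \<in> parcs (comaximal_graph K L) \<longleftrightarrow>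
     S \<in> pverts (comaximal_graph K L) \<and> T \<in> pverts (comaximal_graph K L) \<and>
     S \<noteq> T \<and> lie_generated K L (S \<union> T) = carrier L"
  by (simp add: comaximal_graph_def Let_def)

lemma comaximal_graph_bidirected: "pair_bidirected_digraph (comaximal_graph K L)"
proof (intro pair_bidirected_digraph.intro pair_sym_digraph.intro pair_loopfree_digraph.intro
    pair_sym_digraph_axioms.intro pair_loopfree_digraph_axioms.intro)
  show "pair_wf_digraph (comaximal_graph K L)"
    by (rule pair_wf_digraph.intro) (metis comaximal_graph_arcs prod.collapse)+
  then show "pair_wf_digraph (comaximal_graph K L)" .
  show "symmetric (with_proj (comaximal_graph K L))"
    unfolding symmetric_def with_proj_simps
    by (rule symI) (metis comaximal_graph_arcs Un_commute)
  show "fst e \<noteq> snd e" if "e \<in> parcs (comaximal_graph K L)" for e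
    using that by (metis comaximal_graph_arcs prod.collapse)
qed


section \<open>The Frattini ideal\<close>

definition maximal_subalgebra ::
  "('a, 'r) ring_scheme \<Rightarrow> ('a, 'b, 'm) lie_algebra_scheme \<Rightarrow> 'b set \<Rightarrow> bool" where
  "maximal_subalgebra K L M \<longleftrightarrow>
     lie_subalgebra K L M \<and> M \<noteq> carrier L \<and>
     (\<forall>S. lie_subalgebra K L S \<and> M \<subseteq> S \<longrightarrow> S = M \<or> S = carrier L)"

text \<open>Intersecting with \<open>carrier L\<close> only matters if there are no maximal subalgebras.\<close>

definition frattini_subalgebra ::
  "('a, 'r) ring_scheme \<Rightarrow> ('a, 'b, 'm) lie_algebra_scheme \<Rightarrow> 'b set" where
  "frattini_subalgebra K L = carrier L \<inter> \<Inter>{M. maximal_subalgebra K L M}"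

text \<open>\<open>GREATEST\<close> refers to the inclusion order, here and for the nilradical.\<close>

definition frattini_ideal ::
  "('a, 'r) ring_scheme \<Rightarrow> ('a, 'b, 'm) lie_algebra_scheme \<Rightarrow> 'b set" where
  "frattini_ideal K L = (GREATEST I. lie_ideal K L I \<and> I \<subseteq> frattini_subalgebra K L)"


section \<open>Nilpotency and supersolvability\<close>

definition lie_product ::
  "('a, 'r) ring_scheme \<Rightarrow> ('a, 'b, 'm) lie_algebra_scheme \<Rightarrow> 'b set \<Rightarrow> 'b set \<Rightarrow> 'b set" where
  "lie_product K L A B = LinearCombinations.module.span K L {bracket L x y | x y. x \<in> A \<and> y \<in> B}"

abbreviation lie_derived ::
  "('a, 'r) ring_scheme \<Rightarrow> ('a, 'b, 'm) lie_algebra_scheme \<Rightarrow> 'b set" where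
  "lie_derived K L \<equiv> lie_product K L (carrier L) (carrier L)"

primrec lower_central ::
  "('a, 'r) ring_scheme \<Rightarrow> ('a, 'b, 'm) lie_algebra_scheme \<Rightarrow> nat \<Rightarrow> 'b set" where
  "lower_central K L 0 = carrier L"
| "lower_central K L (Suc i) = lie_product K L (carrier L) (lower_central K L i)"

definition lie_nilpotent ::
  "('a, 'r) ring_scheme \<Rightarrow> ('a, 'b, 'm) lie_algebra_scheme \<Rightarrow> bool" where
  "lie_nilpotent K L \<longleftrightarrow> (\<exists>i. lower_central K L i = {\<zero>\<^bsub>L\<^esub>})"

definition nilradical ::
  "('a, 'r) ring_scheme \<Rightarrow> ('a, 'b, 'm) lie_algebra_scheme \<Rightarrow> 'b set" where
  "nilradical K L = (GREATEST I. lie_ideal K L I \<and> lie_nilpotent K (L\<lparr>carrier := I\<rparr>))"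

definition supersolvable ::
  "('a, 'r) ring_scheme \<Rightarrow> ('a, 'b, 'm) lie_algebra_scheme \<Rightarrow> bool" where
  "supersolvable K L \<longleftrightarrow>
     (\<exists>m I. I 0 = {\<zero>\<^bsub>L\<^esub>} \<and> I m = carrier L \<and>
        (\<forall>i<m. I i \<subset> I (Suc i)) \<and>
        (\<forall>i\<le>m. lie_ideal K L (I i) \<and> vectorspace.dim K (L\<lparr>carrier := I i\<rparr>) = i))"

definition codimension ::
  "('a, 'r) ring_scheme \<Rightarrow> ('a, 'b, 'm) lie_algebra_scheme \<Rightarrow> 'b set \<Rightarrow> nat" where
  "codimension K L I = vectorspace.dim K (lie_quotient L I)"


section \<open>Gaussian binomial coefficients\<close>

text \<open>
  For a prime power \<open>q\<close>, this product counts the \<open>k\<close>-dimensional subspaces of an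
  \<open>n\<close>-dimensional space over a field with \<open>q\<close> elements. If \<open>k > n\<close>, the factor for
  \<open>i = n\<close> vanishes.
\<close>

definition gaussian_binomial :: "nat \<Rightarrow> nat \<Rightarrow> nat \<Rightarrow> real" where
  "gaussian_binomial q n k = (\<Prod>i<k. (real q ^ (n - i) - 1) / (real q ^ (i + 1) - 1))"

end

theory Submission
  imports Defs
begin

text \<open>
  The Gaussian binomials count all proper nonzero subspaces of \<open>Q = L / \<phi>(L)\<close>, so the hypothesis says that
  every subspace of \<open>Q\<close> is a subalgebra. Hence \<open>[x, y]\<close> always lies in the span of \<open>x\<close> and \<open>y\<close>, and
  \<open>Q\<close> is abelian or of the form \<open>A + K x\<close> with \<open>A\<close> abelian and \<open>ad x\<close> the identity on \<open>A\<close>. Let \<open>N\<close> be \<open>L\<close>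
  in the first case and the preimage of \<open>A\<close> in the second.

  A subalgebra \<open>S\<close> with \<open>S + \<phi>(L) = L\<close> is \<open>L\<close>. Taking for \<open>S\<close> the Fitting null component of \<open>ad a\<close>,
  \<open>a \<in> N\<close>, shows that \<open>N\<close> acts nilpotently on \<open>L\<close>; taking for \<open>S\<close> the sum of the generalised eigenspaces of
  \<open>ad x\<close> shows that \<open>ad x\<close> is triangularisable. By Engel's theorem \<open>N\<close> is nilpotent, and common
  eigenvectors of \<open>N + K x = L\<close> in the quotients of \<open>L\<close> yield a flag of ideals. Taking \<open>S = L\<^sup>2 + K x\<close>
  shows that \<open>N = L\<^sup>2\<close> in the second case.
\<close>

section \<open>Counting subspaces of a finite vector space\<close>

context vectorspace
begin

lemma subspace_iff:
  "VectorSpace.subspace K W V \<longleftrightarrow> W \<subseteq> carrier V \<and> \<zero>\<^bsub>V\<^esub> \<in> W \<and>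
     (\<forall>x\<in>W. \<forall>y\<in>W. x \<oplus>\<^bsub>V\<^esub> y \<in> W) \<and> (\<forall>a\<in>carrier K. \<forall>x\<in>W. a \<odot>\<^bsub>V\<^esub> x \<in> W)"
  using module_axioms vectorspace_axioms
  by (auto simp: VectorSpace.subspace_def LinearCombinations.submodule_def)

lemma subspaceI:
  assumes "W \<subseteq> carrier V" "\<zero>\<^bsub>V\<^esub> \<in> W"
    and "\<And>x y. x \<in> W \<Longrightarrow> y \<in> W \<Longrightarrow> x \<oplus>\<^bsub>V\<^esub> y \<in> W"
    and "\<And>a x. a \<in> carrier K \<Longrightarrow> x \<in> W \<Longrightarrow> a \<odot>\<^bsub>V\<^esub> x \<in> W"
  shows "VectorSpace.subspace K W V"
  using assms by (simp add: subspace_iff)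

lemma subspaceD:
  assumes "VectorSpace.subspace K W V"
  shows "W \<subseteq> carrier V" "\<And>x. x \<in> W \<Longrightarrow> x \<in> carrier V" "\<zero>\<^bsub>V\<^esub> \<in> W"
    and "\<And>x y. x \<in> W \<Longrightarrow> y \<in> W \<Longrightarrow> x \<oplus>\<^bsub>V\<^esub> y \<in> W"
    and "\<And>a x. a \<in> carrier K \<Longrightarrow> x \<in> W \<Longrightarrow> a \<odot>\<^bsub>V\<^esub> x \<in> W"
  using assms by (auto simp: subspace_iff)

lemma subspace_uminus:
  assumes "VectorSpace.subspace K W V" "x \<in> W"
  shows "\<ominus>\<^bsub>V\<^esub> x \<in> W"
  using assms subspaceD[OF assms(1)] by (metis R.a_inv_closed R.one_closed smult_minus_1)

lemma subspace_minus:
  assumes "VectorSpace.subspace K W V" "x \<in> W" "y \<in> W"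
  shows "x \<ominus>\<^bsub>V\<^esub> y \<in> W"
  using assms by (simp add: a_minus_def subspaceD(4) subspace_uminus)

lemma subspace_add_left_cancel:
  assumes "VectorSpace.subspace K W V" "x \<in> W" "y \<in> carrier V"
  shows "x \<oplus>\<^bsub>V\<^esub> y \<in> W \<longleftrightarrow> y \<in> W"
proof
  assume "x \<oplus>\<^bsub>V\<^esub> y \<in> W"
  then have "\<ominus>\<^bsub>V\<^esub> x \<oplus>\<^bsub>V\<^esub> (x \<oplus>\<^bsub>V\<^esub> y) \<in> W"
    using assms by (simp add: subspaceD(4) subspace_uminus)
  then show "y \<in> W" using assms subspaceD(2)[OF assms(1)] by (simp add: M.r_neg1)
qed (use assms in \<open>simp add: subspaceD(4)\<close>)

lemma subspace_add_right_cancel: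
  assumes "VectorSpace.subspace K W V" "y \<in> W" "x \<in> carrier V"
  shows "x \<oplus>\<^bsub>V\<^esub> y \<in> W \<longleftrightarrow> x \<in> W"
  using assms subspace_add_left_cancel[OF assms] subspaceD(2)[OF assms(1)] by (simp add: M.a_comm)

lemma subspace_smult_cancel:
  assumes "VectorSpace.subspace K W V" "a \<in> carrier K" "a \<noteq> \<zero>\<^bsub>K\<^esub>" "x \<in> carrier V" "a \<odot>\<^bsub>V\<^esub> x \<in> W"
  shows "x \<in> W"
proof -
  have a: "a \<in> Units K" using assms field_Units by auto
  have "inv\<^bsub>K\<^esub> a \<odot>\<^bsub>V\<^esub> (a \<odot>\<^bsub>V\<^esub> x) = x"
    using a assms by (simp flip: smult_assoc1)
  then show ?thesis using subspaceD(5)[OF assms(1) R.Units_inv_closed[OF a] assms(5)] by simp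
qed

lemma subspace_zero: "VectorSpace.subspace K {\<zero>\<^bsub>V\<^esub>} V"
  by (rule subspaceI) auto

lemma subspace_carrier: "VectorSpace.subspace K (carrier V) V"
  by (rule subspaceI) auto

section \<open>Enlarging a subspace by one vector\<close>

definition adjoin :: "'c set \<Rightarrow> 'c \<Rightarrow> 'c set" where
  "adjoin W v = {u \<oplus>\<^bsub>V\<^esub> a \<odot>\<^bsub>V\<^esub> v | u a. u \<in> W \<and> a \<in> carrier K}"

lemma adjoin_subspace:
  assumes W: "VectorSpace.subspace K W V" and v: "v \<in> carrier V"
  shows "VectorSpace.subspace K (adjoin W v) V"
proof (rule subspaceI)
  note D = subspaceD[OF W]
  show "adjoin W v \<subseteq> carrier V" using D v by (auto simp: adjoin_def)
  have "\<zero>\<^bsub>V\<^esub> = \<zero>\<^bsub>V\<^esub> \<oplus>\<^bsub>V\<^esub> \<zero>\<^bsub>K\<^esub> \<odot>\<^bsub>V\<^esub> v" using v by simp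
  then show "\<zero>\<^bsub>V\<^esub> \<in> adjoin W v" using D unfolding adjoin_def by blast
next
  note D = subspaceD[OF W]
  fix x y assume "x \<in> adjoin W v" "y \<in> adjoin W v"
  then obtain u a u' a' where *: "u \<in> W" "a \<in> carrier K" "u' \<in> W" "a' \<in> carrier K"
    and xy: "x = u \<oplus>\<^bsub>V\<^esub> a \<odot>\<^bsub>V\<^esub> v" "y = u' \<oplus>\<^bsub>V\<^esub> a' \<odot>\<^bsub>V\<^esub> v" by (auto simp: adjoin_def)
  have "x \<oplus>\<^bsub>V\<^esub> y = (u \<oplus>\<^bsub>V\<^esub> u') \<oplus>\<^bsub>V\<^esub> (a \<oplus>\<^bsub>K\<^esub> a') \<odot>\<^bsub>V\<^esub> v"
    using * D v by (simp add: xy smult_l_distr M.a_ac)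
  then show "x \<oplus>\<^bsub>V\<^esub> y \<in> adjoin W v" using * D(4) unfolding adjoin_def by blast
next
  note D = subspaceD[OF W]
  fix b x assume b: "b \<in> carrier K" and "x \<in> adjoin W v"
  then obtain u a where *: "u \<in> W" "a \<in> carrier K" and x: "x = u \<oplus>\<^bsub>V\<^esub> a \<odot>\<^bsub>V\<^esub> v"
    by (auto simp: adjoin_def)
  have "b \<odot>\<^bsub>V\<^esub> x = b \<odot>\<^bsub>V\<^esub> u \<oplus>\<^bsub>V\<^esub> (b \<otimes>\<^bsub>K\<^esub> a) \<odot>\<^bsub>V\<^esub> v"
    using * b D v by (simp add: x smult_r_distr smult_assoc1)
  then show "b \<odot>\<^bsub>V\<^esub> x \<in> adjoin W v" using * b D(5) unfolding adjoin_def by blast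
qed

lemma adjoinI: "u \<in> W \<Longrightarrow> a \<in> carrier K \<Longrightarrow> u \<oplus>\<^bsub>V\<^esub> a \<odot>\<^bsub>V\<^esub> v \<in> adjoin W v"
  unfolding adjoin_def by blast

lemma adjoinE:
  assumes "y \<in> adjoin W v"
  obtains u a where "u \<in> W" "a \<in> carrier K" "y = u \<oplus>\<^bsub>V\<^esub> a \<odot>\<^bsub>V\<^esub> v"
  using assms unfolding adjoin_def by blast

lemma subset_adjoin:
  assumes "VectorSpace.subspace K W V" "v \<in> carrier V"
  shows "W \<subseteq> adjoin W v"
proof
  fix u assume "u \<in> W"
  then have "u \<oplus>\<^bsub>V\<^esub> \<zero>\<^bsub>K\<^esub> \<odot>\<^bsub>V\<^esub> v \<in> adjoin W v" by (intro adjoinI) auto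
  then show "u \<in> adjoin W v" using subspaceD(2)[OF assms(1) \<open>u \<in> W\<close>] assms(2) by simp
qed

lemma mem_adjoin:
  assumes "VectorSpace.subspace K W V" "v \<in> carrier V"
  shows "v \<in> adjoin W v"
proof -
  have "\<zero>\<^bsub>V\<^esub> \<oplus>\<^bsub>V\<^esub> \<one>\<^bsub>K\<^esub> \<odot>\<^bsub>V\<^esub> v \<in> adjoin W v"
    using subspaceD(3)[OF assms(1)] by (intro adjoinI) auto
  then show ?thesis using assms by simp
qed

lemma adjoin_subset:
  assumes "VectorSpace.subspace K U V" "W \<subseteq> U" "v \<in> U"
  shows "adjoin W v \<subseteq> U"
  using assms subspaceD[OF assms(1)] by (auto simp: adjoin_def)

text \<open>Subtracting the two representations puts a multiple of \<open>v\<close> by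
  \<open>a - a'\<close> into \<open>W\<close>; since \<open>v\<close> lies outside \<open>W\<close>,
  that scalar vanishes.\<close>

lemma adjoin_unique:
  assumes W: "VectorSpace.subspace K W V" and v: "v \<in> carrier V" "v \<notin> W"
    and "u \<in> W" "u' \<in> W" "a \<in> carrier K" "a' \<in> carrier K"
    and eq: "u \<oplus>\<^bsub>V\<^esub> a \<odot>\<^bsub>V\<^esub> v = u' \<oplus>\<^bsub>V\<^esub> a' \<odot>\<^bsub>V\<^esub> v"
  shows "u = u' \<and> a = a'"
proof -
  have u: "u \<in> carrier V" "u' \<in> carrier V" using subspaceD(2)[OF W] assms by auto
  have "(u \<oplus>\<^bsub>V\<^esub> a \<odot>\<^bsub>V\<^esub> v) \<ominus>\<^bsub>V\<^esub> (u' \<oplus>\<^bsub>V\<^esub> a' \<odot>\<^bsub>V\<^esub> v)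
      = (u \<ominus>\<^bsub>V\<^esub> u') \<oplus>\<^bsub>V\<^esub> (a \<ominus>\<^bsub>K\<^esub> a') \<odot>\<^bsub>V\<^esub> v"
    using assms(6,7) v u by (simp add: a_minus_def M.minus_add smult_l_distr smult_l_minus M.a_ac)
  then have "(u \<ominus>\<^bsub>V\<^esub> u') \<oplus>\<^bsub>V\<^esub> (a \<ominus>\<^bsub>K\<^esub> a') \<odot>\<^bsub>V\<^esub> v = \<zero>\<^bsub>V\<^esub>"
    using eq assms(6,7) v u by (simp add: M.r_neg a_minus_def)
  then have "(u \<ominus>\<^bsub>V\<^esub> u') \<oplus>\<^bsub>V\<^esub> (a \<ominus>\<^bsub>K\<^esub> a') \<odot>\<^bsub>V\<^esub> v \<in> W"
    using subspaceD(3)[OF W] by simp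
  then have "(a \<ominus>\<^bsub>K\<^esub> a') \<odot>\<^bsub>V\<^esub> v \<in> W"
    using subspace_add_left_cancel[OF W subspace_minus[OF W, of u u']] assms by simp
  then have "a \<ominus>\<^bsub>K\<^esub> a' = \<zero>\<^bsub>K\<^esub>"
    using subspace_smult_cancel[OF W, of "a \<ominus>\<^bsub>K\<^esub> a'" v] assms by auto
  then have "a = a'" using assms(6,7) by simp
  then show ?thesis using eq u assms(6,7) v by simp
qed

lemma card_adjoin:
  assumes W: "VectorSpace.subspace K W V" and v: "v \<in> carrier V" "v \<notin> W"
  shows "card (adjoin W v) = card W * order K"
proof -
  have "adjoin W v = (\<lambda>(u, a). u \<oplus>\<^bsub>V\<^esub> a \<odot>\<^bsub>V\<^esub> v) ` (W \<times> carrier K)"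
    by (auto simp: adjoin_def)
  moreover have "inj_on (\<lambda>(u, a). u \<oplus>\<^bsub>V\<^esub> a \<odot>\<^bsub>V\<^esub> v) (W \<times> carrier K)"
    using adjoin_unique[OF W v] by (fastforce intro!: inj_onI)
  ultimately show ?thesis by (simp add: card_image card_cartesian_product order_def)
qed

section \<open>Cardinality and dimension\<close>

text \<open>The carrier itself is a finite spanning set.\<close>

lemma fin_dim_if_finite: "finite (carrier V) \<Longrightarrow> fin_dim"
  unfolding fin_dim_def using in_own_span[of "carrier V"] span_is_subset2[of "carrier V"]
  by (intro exI[of _ "carrier V"]) auto

text \<open>Coordinates with respect to a finite basis \<open>B\<close> biject \<open>V\<close> with
  the functions from \<open>B\<close> to the field. From here on, finiteness and cardinalities take
  over most of the work of dimensions.\<close>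

lemma card_eq_power_dim:
  assumes fd: "fin_dim"
  shows "card (carrier V) = order K ^ dim"
    and "finite (carrier K) \<Longrightarrow> finite (carrier V)"
proof -
  obtain B where B: "finite B" "basis B" using finite_basis_exists[OF fd] by blast
  have BV: "B \<subseteq> carrier V" using B by (simp add: basis_def)
  have *: "\<forall>v. v \<in> carrier V \<longrightarrow> (\<exists>!a. a \<in> B \<rightarrow>\<^sub>E carrier K \<and> lincomb a B = v)"
    using basis_criterion[OF B(1) BV] B(2) by simp
  have "bij_betw (\<lambda>a. lincomb a B) (B \<rightarrow>\<^sub>E carrier K) (carrier V)"
  proof (rule bij_betwI')
    fix a b assume "a \<in> B \<rightarrow>\<^sub>E carrier K" "b \<in> B \<rightarrow>\<^sub>E carrier K"
    moreover from this have "lincomb a B \<in> carrier V"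
      using BV by (intro lincomb_closed) (auto simp: PiE_def)
    ultimately show "(lincomb a B = lincomb b B) = (a = b)"
      using *[rule_format, of "lincomb a B"] by (metis (no_types, lifting))
  next
    fix a assume "a \<in> B \<rightarrow>\<^sub>E carrier K"
    then show "lincomb a B \<in> carrier V" using BV by (intro lincomb_closed) (auto simp: PiE_def)
  next
    fix v assume "v \<in> carrier V"
    then show "\<exists>a\<in>B \<rightarrow>\<^sub>E carrier K. v = lincomb a B"
      using *[rule_format, of v] by metis
  qed
  then have c: "card (carrier V) = card (B \<rightarrow>\<^sub>E carrier K)"
    and f: "finite (carrier V) = finite (B \<rightarrow>\<^sub>E carrier K)"
    by (auto dest: bij_betw_same_card bij_betw_finite)
  show "card (carrier V) = order K ^ dim"
    using c B by (simp add: card_PiE order_def dim_basis)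
  show "finite (carrier K) \<Longrightarrow> finite (carrier V)" using f B by (simp add: finite_PiE)
qed

lemma order_gt_1:
  assumes "finite (carrier K)"
  shows "1 < order K"
proof -
  have "card {\<zero>\<^bsub>K\<^esub>, \<one>\<^bsub>K\<^esub>} \<le> card (carrier K)" using assms by (intro card_mono) auto
  then show ?thesis by (simp add: order_def)
qed

section \<open>Counting subspaces through their ordered bases\<close>

primrec list_span :: "'c list \<Rightarrow> 'c set" where
  "list_span [] = {\<zero>\<^bsub>V\<^esub>}"
| "list_span (v # xs) = adjoin (list_span xs) v"

text \<open>Linear independence of an ordered list, phrased so that a list grows by one vector at a
  time; this lets the size of the span and the number of lists be found by induction.\<close>

primrec indep_list :: "'c list \<Rightarrow> bool" where
  "indep_list [] \<longleftrightarrow> True"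
| "indep_list (v # xs) \<longleftrightarrow> v \<in> carrier V \<and> v \<notin> list_span xs \<and> indep_list xs"

lemma indep_list_span:
  assumes "indep_list xs"
  shows "VectorSpace.subspace K (list_span xs) V \<and> card (list_span xs) = order K ^ length xs"
  using assms by (induction xs) (simp_all add: subspace_zero adjoin_subspace card_adjoin)

lemma list_span_subset:
  assumes "VectorSpace.subspace K U V" "set xs \<subseteq> U"
  shows "list_span xs \<subseteq> U"
  using assms by (induction xs) (simp_all add: subspaceD(3) adjoin_subset)

text \<open>An independent list of length \<open>i\<close> inside \<open>U\<close> spans
  \<open>order K ^ i\<close> vectors of \<open>U\<close>, which leaves
  \<open>order K ^ d - order K ^ i\<close> choices for the next one. For \<open>k > d\<close> the
  factor at \<open>i = d\<close> is zero.\<close>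

lemma card_indep_lists:
  assumes U: "VectorSpace.subspace K U V" "finite U" "card U = order K ^ d"
  shows "finite {xs. indep_list xs \<and> set xs \<subseteq> U \<and> length xs = k} \<and>
    card {xs. indep_list xs \<and> set xs \<subseteq> U \<and> length xs = k} = (\<Prod>i<k. order K ^ d - order K ^ i)"
proof (induction k)
  case 0
  have "{xs. indep_list xs \<and> set xs \<subseteq> U \<and> length xs = 0} = {[]}" by auto
  then show ?case by simp
next
  case (Suc k)
  let ?S = "{xs. indep_list xs \<and> set xs \<subseteq> U \<and> length xs = k}"
  have eq: "{xs. indep_list xs \<and> set xs \<subseteq> U \<and> length xs = Suc k}
      = (\<lambda>(xs, v). v # xs) ` (SIGMA xs:?S. U - list_span xs)" (is "?T = ?f ` ?P")
  proof (intro subset_antisym subsetI)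
    fix ws assume "ws \<in> ?T"
    then obtain v xs where "ws = v # xs" "(xs, v) \<in> ?P" by (cases ws) auto
    then show "ws \<in> ?f ` ?P" by force
  qed (use subspaceD(2)[OF U(1)] in auto)
  have "card (U - list_span xs) = order K ^ d - order K ^ k" if "xs \<in> ?S" for xs
    using that U indep_list_span[of xs] list_span_subset[OF U(1), of xs]
    by (simp add: card_Diff_subset finite_subset)
  then have "card ?P = (\<Sum>xs\<in>?S. order K ^ d - order K ^ k)"
    using Suc U by (simp add: card_SigmaI)
  moreover have "inj_on ?f ?P" by (auto simp: inj_on_def)
  moreover have "finite ?P" using Suc U by (intro finite_SigmaI) auto
  ultimately show ?case using Suc unfolding eq by (simp add: card_image)
qed

text \<open>Double counting: an independent list of length \<open>k\<close> is an ordered basis of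
  exactly one subspace, its span, and all subspaces of size \<open>order K ^ k\<close> have equally
  many ordered bases.\<close>

lemma card_subspaces_mult:
  assumes fin: "finite (carrier V)" and n: "card (carrier V) = order K ^ n"
  shows "card {W. VectorSpace.subspace K W V \<and> card W = order K ^ k} *
    (\<Prod>i<k. order K ^ k - order K ^ i) = (\<Prod>i<k. order K ^ n - order K ^ i)"
proof -
  let ?S = "{W. VectorSpace.subspace K W V \<and> card W = order K ^ k}"
  let ?B = "\<lambda>W. {xs. indep_list xs \<and> set xs \<subseteq> W \<and> length xs = k}"
  have finW: "finite W" if "W \<in> ?S" for W
    using that fin subspaceD(1) finite_subset by blast
  have "finite ?S"
    by (rule finite_subset[of _ "Pow (carrier V)"]) (use fin subspaceD(1) in auto)
  \<comment> \<open>The span lies in \<open>W\<close> and has the same finite cardinality. This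
    yields the disjointness of the sets \<open>?B W\<close> below.\<close>
  have span: "list_span xs = W" if "W \<in> ?S" "xs \<in> ?B W" for W xs
    using that finW[OF that(1)] indep_list_span[of xs] list_span_subset[of W xs]
    by (intro card_subset_eq) auto
  have carr: "set xs \<subseteq> list_span xs" if "indep_list xs" for xs
    using that
  proof (induction xs)
    case (Cons v xs)
    then show ?case
      using indep_list_span[of xs] subset_adjoin[of "list_span xs" v] mem_adjoin[of "list_span xs" v]
      by auto
  qed simp
  have "?B (carrier V) = (\<Union>W\<in>?S. ?B W)"
  proof (intro subset_antisym subsetI)
    fix xs assume "xs \<in> ?B (carrier V)"
    then have "list_span xs \<in> ?S" "xs \<in> ?B (list_span xs)"
      using indep_list_span[of xs] carr by auto
    then show "xs \<in> (\<Union>W\<in>?S. ?B W)" by blast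
  qed (use subspaceD(1) in blast)
  then have "card (?B (carrier V)) = (\<Sum>W\<in>?S. card (?B W))"
  proof (simp only:, intro card_UN_disjoint ballI impI)
    show "?B W \<inter> ?B W' = {}" if "W \<in> ?S" "W' \<in> ?S" "W \<noteq> W'" for W W'
      using that span[OF that(1)] span[OF that(2)] by fast
    show "finite (?B W)" if "W \<in> ?S" for W
      using card_indep_lists[of W k k] finW[OF that] that by simp
  qed (rule \<open>finite ?S\<close>)
  also have "\<dots> = (\<Sum>W\<in>?S. \<Prod>i<k. order K ^ k - order K ^ i)"
  proof (rule sum.cong[OF refl])
    fix W assume W: "W \<in> ?S"
    show "card (?B W) = (\<Prod>i<k. order K ^ k - order K ^ i)"
      using card_indep_lists[of W k k] finW[OF W] W by simp
  qed
  finally show ?thesis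
    using card_indep_lists[OF subspace_carrier fin n, of k] by simp
qed

text \<open>The double count is divided out in the reals. Pulling \<open>q ^ i\<close> out of every
  factor leaves the same product of powers on both sides, which cancels.\<close>

lemma card_subspaces_of_dim:
  assumes fin: "finite (carrier K)" "finite (carrier V)" and n: "card (carrier V) = order K ^ n"
    and k: "k \<le> n"
  shows "real (card {W. VectorSpace.subspace K W V \<and> card W = order K ^ k})
    = gaussian_binomial (order K) n k"
proof -
  define q where "q = real (order K)"
  have q: "q > 1" using order_gt_1[OF fin(1)] by (simp add: q_def)
  have diff: "real (\<Prod>i<k. order K ^ m - order K ^ i) = (\<Prod>i<k. q ^ i) * (\<Prod>i<k. q ^ (m - i) - 1)"
    if "k \<le> m" for m
  proof -
    have "real (order K ^ m - order K ^ i) = q ^ i * (q ^ (m - i) - 1)" if "i < k" for i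
    proof -
      have "order K ^ i \<le> order K ^ m"
        using that \<open>k \<le> m\<close> order_gt_1[OF fin(1)] by (intro power_increasing) auto
      moreover have "q ^ m = q ^ i * q ^ (m - i)"
        using that \<open>k \<le> m\<close> by (simp flip: power_add)
      ultimately show ?thesis by (simp add: of_nat_diff q_def right_diff_distrib)
    qed
    then show ?thesis by (simp add: prod.distrib)
  qed
  \<comment> \<open>The basis count produces the exponents \<open>k - i\<close>, the Gaussian
    binomial has \<open>i + 1\<close>; they are the same factors in reverse order.\<close>
  have rev: "(\<Prod>i<k. q ^ (k - i) - 1) = (\<Prod>i<k. q ^ (i + 1) - 1)"
    using prod.nat_diff_reindex[of "\<lambda>i. q ^ (i + 1) - 1" k]
    by (simp add: Suc_diff_Suc cong: prod.cong_simp)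
  have pos: "(\<Prod>i<k. q ^ (i + 1) - 1) \<noteq> 0"
    using q one_less_power[of q "Suc _"] by (auto simp: less_imp_neq[symmetric] simp del: power_Suc)
  have "real (card {W. VectorSpace.subspace K W V \<and> card W = order K ^ k}) *
      ((\<Prod>i<k. q ^ i) * (\<Prod>i<k. q ^ (i + 1) - 1)) = (\<Prod>i<k. q ^ i) * (\<Prod>i<k. q ^ (n - i) - 1)"
    using arg_cong[OF card_subspaces_mult[OF fin(2) n, of k], of real] diff[of k] diff[OF k] rev
    by simp
  then show ?thesis
    using q pos by (simp add: gaussian_binomial_def prod_dividef field_simps flip: q_def)
qed

lemma subspace_card:
  assumes fin: "finite (carrier K)" "finite (carrier V)" and W: "VectorSpace.subspace K W V"
  shows "card W = order K ^ vectorspace.dim K (V\<lparr>carrier := W\<rparr>)"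
proof -
  interpret W: vectorspace K "V\<lparr>carrier := W\<rparr>" by (rule subspace_is_vs[OF W])
  have "finite W" using fin(2) subspaceD(1)[OF W] finite_subset by blast
  then show ?thesis using W.card_eq_power_dim(1) W.fin_dim_if_finite by simp
qed

text \<open>Every subspace has a power of \<open>order K\<close> as its size, so the subspaces are
  sorted by exponent; the exponents \<open>0\<close> and \<open>n\<close> belong to the zero space
  and the whole space only.\<close>

lemma card_proper_subspaces:
  assumes fin: "finite (carrier K)" "finite (carrier V)" and n: "card (carrier V) = order K ^ n"
  shows "finite {W. VectorSpace.subspace K W V \<and> W \<noteq> {\<zero>\<^bsub>V\<^esub>} \<and> W \<noteq> carrier V}"
    and "real (card {W. VectorSpace.subspace K W V \<and> W \<noteq> {\<zero>\<^bsub>V\<^esub>} \<and> W \<noteq> carrier V})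
      = (\<Sum>k = 1..<n. gaussian_binomial (order K) n k)"
proof -
  let ?S = "\<lambda>k. {W. VectorSpace.subspace K W V \<and> card W = order K ^ k}"
  have q: "1 < order K" by (rule order_gt_1[OF fin(1)])
  have finS: "finite {W. VectorSpace.subspace K W V}"
    by (rule finite_subset[of _ "Pow (carrier V)"]) (use fin subspaceD(1) in auto)
  show "finite {W. VectorSpace.subspace K W V \<and> W \<noteq> {\<zero>\<^bsub>V\<^esub>} \<and> W \<noteq> carrier V}"
    by (rule finite_subset[OF _ finS]) auto
  have "{W. VectorSpace.subspace K W V \<and> W \<noteq> {\<zero>\<^bsub>V\<^esub>} \<and> W \<noteq> carrier V} = (\<Union>k\<in>{1..<n}. ?S k)"
  proof (intro subset_antisym subsetI)
    fix W assume "W \<in> {W. VectorSpace.subspace K W V \<and> W \<noteq> {\<zero>\<^bsub>V\<^esub>} \<and> W \<noteq> carrier V}"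
    then have W: "VectorSpace.subspace K W V" "W \<noteq> {\<zero>\<^bsub>V\<^esub>}" "W \<noteq> carrier V" by auto
    obtain d where d: "card W = order K ^ d" using subspace_card[OF fin W(1)] by blast
    have "card W < card (carrier V)"
      using subspaceD(1)[OF W(1)] W(3) fin(2) by (intro psubset_card_mono) auto
    then have "d < n" using d n q by (simp add: power_strict_increasing_iff)
    moreover have "d \<noteq> 0"
    proof
      assume "d = 0"
      then have "card W = 1" using d by simp
      then show False using W(2) subspaceD(3)[OF W(1)] by (auto simp: card_1_singleton_iff)
    qed
    ultimately show "W \<in> (\<Union>k\<in>{1..<n}. ?S k)" using d W(1) by force
  next
    fix W assume "W \<in> (\<Union>k\<in>{1..<n}. ?S k)"
    then obtain k where k: "1 \<le> k" "k < n" "VectorSpace.subspace K W V" "card W = order K ^ k" by auto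
    moreover from k have "card W \<noteq> 1" "card W \<noteq> card (carrier V)" using q n by auto
    then have "W \<noteq> {\<zero>\<^bsub>V\<^esub>}" "W \<noteq> carrier V" by auto
    ultimately show "W \<in> {W. VectorSpace.subspace K W V \<and> W \<noteq> {\<zero>\<^bsub>V\<^esub>} \<and> W \<noteq> carrier V}"
      by simp
  qed
  then have "card {W. VectorSpace.subspace K W V \<and> W \<noteq> {\<zero>\<^bsub>V\<^esub>} \<and> W \<noteq> carrier V}
      = (\<Sum>k = 1..<n. card (?S k))"
  proof (simp only:, intro card_UN_disjoint ballI impI)
    show "finite (?S k)" for k by (rule finite_subset[OF _ finS]) auto
    show "?S i \<inter> ?S j = {}" if "i \<noteq> j" for i j
      using that power_inject_exp[OF q, of i j] by auto
  qed simp
  then show "real (card {W. VectorSpace.subspace K W V \<and> W \<noteq> {\<zero>\<^bsub>V\<^esub>} \<and> W \<noteq> carrier V})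
      = (\<Sum>k = 1..<n. gaussian_binomial (order K) n k)"
    using card_subspaces_of_dim[OF fin n] by simp
qed

end


section \<open>Generalised eigenspaces of inner derivations\<close>

lemma funpow_eventually_periodic:
  assumes "finite A" "f \<in> A \<rightarrow> A" "y \<in> A"
  obtains m where "m > 0" "(f ^^ (m + m)) y = (f ^^ m) y"
proof -
  have "(f ^^ i) y \<in> A" for i using assms by (induction i) auto
  then have "\<not> inj (\<lambda>i. (f ^^ i) y)"
    using assms(1) finite_imageD[of "\<lambda>i. (f ^^ i) y" UNIV] finite_subset[of "range (\<lambda>i. (f ^^ i) y)" A]
    by (metis image_subsetI infinite_UNIV_nat)
  then obtain i p where ip: "(f ^^ i) y = (f ^^ (i + p)) y" "p > 0"
    unfolding inj_def by (metis less_imp_add_positive linorder_neqE_nat)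
  have shift: "(f ^^ (i + j + p)) y = (f ^^ (i + j)) y" for j
    using arg_cong[OF ip(1), of "f ^^ j"]
    by (simp add: add_ac flip: comp_apply[of "f ^^ _" "f ^^ _"] funpow_add)
  have per: "(f ^^ (i + j + k * p)) y = (f ^^ (i + j)) y" for j k
  proof (induction k)
    case (Suc k)
    have "i + j + Suc k * p = i + (j + k * p) + p" by simp
    then show ?case using shift[of "j + k * p"] Suc by (simp add: ac_simps)
  qed simp
  \<comment> \<open>A positive multiple of the period \<open>p\<close> that is at least the
    preperiod \<open>i\<close>; going from \<open>?m\<close> to \<open>?m + ?m\<close> adds
    \<open>i + 1\<close> full periods.\<close>
  let ?m = "(i + 1) * p"
  have "i \<le> ?m" using ip(2) by (cases p) auto
  then have "(f ^^ (?m + ?m)) y = (f ^^ ?m) y"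
    using per[of "?m - i" "i + 1"] by simp
  then show thesis using that[of ?m] ip(2) by simp
qed

text \<open>The source of maximal subalgebras, maximal invariant subspaces and maximal ideals in the
  proofs below.\<close>

lemma finite_maximal_set:
  assumes "finite A" "S \<in> A"
  obtains M where "M \<in> A" "\<forall>T\<in>A. M \<subseteq> T \<longrightarrow> M = T"
  using finite_has_maximal[of A] assms by blast

context lie_algebra
begin

section \<open>Bracket identities, ideals and subalgebras\<close>

lemma bracket_zero_left [simp]: "x \<in> carrier L \<Longrightarrow> bracket L \<zero>\<^bsub>L\<^esub> x = \<zero>\<^bsub>L\<^esub>"
  using bracket_smult_left[of "\<zero>\<^bsub>K\<^esub>" "\<zero>\<^bsub>L\<^esub>" x] by simp

lemma bracket_zero_right [simp]: "x \<in> carrier L \<Longrightarrow> bracket L x \<zero>\<^bsub>L\<^esub> = \<zero>\<^bsub>L\<^esub>"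
  using bracket_smult_right[of "\<zero>\<^bsub>K\<^esub>" x "\<zero>\<^bsub>L\<^esub>"] by simp

lemma bracket_uminus_right:
  "x \<in> carrier L \<Longrightarrow> y \<in> carrier L \<Longrightarrow> bracket L x (\<ominus>\<^bsub>L\<^esub> y) = \<ominus>\<^bsub>L\<^esub> bracket L x y"
  by (metis M.add.inv_closed M.l_neg M.minus_equality bracket_add_right bracket_closed bracket_zero_right)

text \<open>The Jacobi identity read as a Leibniz rule for \<open>ad x\<close>; antisymmetry turns
  the two other cyclic terms around.\<close>

lemma bracket_derivation:
  assumes "x \<in> carrier L" "y \<in> carrier L" "z \<in> carrier L"
  shows "bracket L x (bracket L y z) = bracket L (bracket L x y) z \<oplus>\<^bsub>L\<^esub> bracket L y (bracket L x z)"
proof -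
  have 1: "bracket L y (bracket L z x) = \<ominus>\<^bsub>L\<^esub> bracket L y (bracket L x z)"
    using assms bracket_antisym[of z x] by (simp add: bracket_uminus_right)
  have 2: "bracket L z (bracket L x y) = \<ominus>\<^bsub>L\<^esub> bracket L (bracket L x y) z"
    using assms bracket_antisym[of z "bracket L x y"] by simp
  have "bracket L x (bracket L y z) \<oplus>\<^bsub>L\<^esub>
      \<ominus>\<^bsub>L\<^esub> (bracket L (bracket L x y) z \<oplus>\<^bsub>L\<^esub> bracket L y (bracket L x z)) = \<zero>\<^bsub>L\<^esub>"
    using jacobi[OF assms] assms unfolding 1 2 by (simp add: M.minus_add M.a_ac)
  then show ?thesis using assms
    by (metis M.add.inv_closed M.add.m_closed M.minus_equality M.minus_minus bracket_closed)
qed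

lemma lie_ideal_subspace: "lie_ideal K L I \<Longrightarrow> VectorSpace.subspace K I L"
  by (simp add: lie_ideal_def)

lemma lie_ideal_bracket_right: "lie_ideal K L I \<Longrightarrow> x \<in> carrier L \<Longrightarrow> y \<in> I \<Longrightarrow> bracket L x y \<in> I"
  by (simp add: lie_ideal_def)

lemma lie_ideal_bracket_left:
  assumes "lie_ideal K L I" "x \<in> carrier L" "y \<in> I"
  shows "bracket L y x \<in> I"
  using assms lie_ideal_bracket_right[OF assms] bracket_antisym[of y x]
    subspaceD(2)[OF lie_ideal_subspace] subspace_uminus[OF lie_ideal_subspace]
  by metis

lemma lie_ideal_subalgebra: "lie_ideal K L I \<Longrightarrow> lie_subalgebra K L I"
  unfolding lie_subalgebra_def lie_ideal_def using subspaceD(2) by blast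

lemma lie_subalgebra_subspace: "lie_subalgebra K L S \<Longrightarrow> VectorSpace.subspace K S L"
  by (simp add: lie_subalgebra_def)

lemma lie_subalgebra_zero: "lie_subalgebra K L {\<zero>\<^bsub>L\<^esub>}"
  by (simp add: lie_subalgebra_def subspace_zero)

lemma lie_subalgebra_carrier: "lie_subalgebra K L (carrier L)"
  by (simp add: lie_subalgebra_def subspace_carrier)

lemma lie_subalgebra_lie_algebra:
  assumes "lie_subalgebra K L S"
  shows "lie_algebra K (L\<lparr>carrier := S\<rparr>)"
proof -
  have S: "VectorSpace.subspace K S L" by (rule lie_subalgebra_subspace[OF assms])
  note D = subspaceD(2)[OF S]
  have "vectorspace K (L\<lparr>carrier := S\<rparr>)" by (rule subspace_is_vs[OF S])
  moreover have "lie_algebra_axioms K (L\<lparr>carrier := S\<rparr>)"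
    using assms D by unfold_locales
      (auto simp: lie_subalgebra_def bracket_add_left bracket_add_right bracket_smult_left
        bracket_smult_right jacobi)
  ultimately show ?thesis by (rule lie_algebra.intro)
qed

text \<open>The sum of the generalised eigenspaces of \<open>ad x\<close> for the eigenvalues \<open>-c\<close>, \<open>c \<in> C\<close>.\<close>

inductive_set gen_eigen :: "'b \<Rightarrow> 'a set \<Rightarrow> 'b set" for x C where
  zero: "\<zero>\<^bsub>L\<^esub> \<in> gen_eigen x C"
| step: "\<lbrakk>v \<in> carrier L; c \<in> C; bracket L x v \<oplus>\<^bsub>L\<^esub> c \<odot>\<^bsub>L\<^esub> v \<in> gen_eigen x C\<rbrakk> \<Longrightarrow> v \<in> gen_eigen x C"

lemma gen_eigen_closed: "v \<in> gen_eigen x C \<Longrightarrow> v \<in> carrier L"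
  by (induction rule: gen_eigen.induct) auto

context
  fixes x C
  assumes x: "x \<in> carrier L" and C: "C \<subseteq> carrier K"
begin

text \<open>\<open>ad x + d\<close> commutes with each \<open>ad x + c\<close>, so it can be pushed
  through the chain of operators that takes \<open>v\<close> to zero.\<close>

lemma gen_eigen_shift:
  assumes "v \<in> gen_eigen x C" "d \<in> carrier K"
  shows "bracket L x v \<oplus>\<^bsub>L\<^esub> d \<odot>\<^bsub>L\<^esub> v \<in> gen_eigen x C"
  using assms(1)
proof (induction rule: gen_eigen.induct)
  case zero
  then show ?case using x assms by (simp add: gen_eigen.zero)
next
  case (step v c)
  have c: "c \<in> carrier K" using step C by auto
  have "bracket L x (bracket L x v \<oplus>\<^bsub>L\<^esub> d \<odot>\<^bsub>L\<^esub> v) \<oplus>\<^bsub>L\<^esub> c \<odot>\<^bsub>L\<^esub> (bracket L x v \<oplus>\<^bsub>L\<^esub> d \<odot>\<^bsub>L\<^esub> v)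
      = bracket L x (bracket L x v \<oplus>\<^bsub>L\<^esub> c \<odot>\<^bsub>L\<^esub> v) \<oplus>\<^bsub>L\<^esub> d \<odot>\<^bsub>L\<^esub> (bracket L x v \<oplus>\<^bsub>L\<^esub> c \<odot>\<^bsub>L\<^esub> v)"
    using x c step(1) assms(2)
    by (simp add: bracket_add_right bracket_smult_right smult_r_distr M.a_ac R.m_comm flip: smult_assoc1)
  then show ?case using step x c assms(2) by - (rule gen_eigen.step[of _ c], auto)
qed

text \<open>Induction on the chain of the first summand: \<open>ad x + c\<close> brings
  \<open>v\<close> one step closer to zero, while \<open>w\<close> remains in the set by
  \<open>gen_eigen_shift\<close>.\<close>

lemma gen_eigen_add:
  assumes "v \<in> gen_eigen x C" "w \<in> gen_eigen x C"
  shows "v \<oplus>\<^bsub>L\<^esub> w \<in> gen_eigen x C"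
  using assms
proof (induction arbitrary: w rule: gen_eigen.induct)
  case zero
  then show ?case by (simp add: gen_eigen_closed)
next
  case (step v c)
  have c: "c \<in> carrier K" using step C by auto
  have w: "w \<in> carrier L" using step by (simp add: gen_eigen_closed)
  have "bracket L x (v \<oplus>\<^bsub>L\<^esub> w) \<oplus>\<^bsub>L\<^esub> c \<odot>\<^bsub>L\<^esub> (v \<oplus>\<^bsub>L\<^esub> w)
      = (bracket L x v \<oplus>\<^bsub>L\<^esub> c \<odot>\<^bsub>L\<^esub> v) \<oplus>\<^bsub>L\<^esub> (bracket L x w \<oplus>\<^bsub>L\<^esub> c \<odot>\<^bsub>L\<^esub> w)"
    using x c step(1) w by (simp add: bracket_add_right smult_r_distr M.a_ac)
  then show ?case using step w gen_eigen_shift[OF step.prems c]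
    by - (rule gen_eigen.step[of _ c], auto)
qed

lemma gen_eigen_smult:
  assumes "v \<in> gen_eigen x C" "a \<in> carrier K"
  shows "a \<odot>\<^bsub>L\<^esub> v \<in> gen_eigen x C"
  using assms(1)
proof (induction rule: gen_eigen.induct)
  case zero
  then show ?case using assms by (simp add: gen_eigen.zero)
next
  case (step v c)
  have c: "c \<in> carrier K" using step C by auto
  have "bracket L x (a \<odot>\<^bsub>L\<^esub> v) \<oplus>\<^bsub>L\<^esub> c \<odot>\<^bsub>L\<^esub> (a \<odot>\<^bsub>L\<^esub> v) = a \<odot>\<^bsub>L\<^esub> (bracket L x v \<oplus>\<^bsub>L\<^esub> c \<odot>\<^bsub>L\<^esub> v)"
    using x c step(1) assms(2)
    by (simp add: bracket_smult_right smult_r_distr R.m_comm flip: smult_assoc1)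
  then show ?case using step assms(2) by - (rule gen_eigen.step[of _ c], auto)
qed

text \<open>Eigenvalues add under the bracket: \<open>ad x + c + d\<close> sends
  \<open>[v, w]\<close> to \<open>[(ad x + c) v, w] + [v, (ad x + d) w]\<close>. In either term one
  argument has a shorter chain, whence the nested induction.\<close>

lemma gen_eigen_bracket:
  assumes add: "\<And>c d. c \<in> C \<Longrightarrow> d \<in> C \<Longrightarrow> c \<oplus>\<^bsub>K\<^esub> d \<in> C"
    and "v \<in> gen_eigen x C" "w \<in> gen_eigen x C"
  shows "bracket L v w \<in> gen_eigen x C"
  using assms(2,3)
proof (induction arbitrary: w rule: gen_eigen.induct)
  case zero
  then show ?case by (simp add: gen_eigen_closed gen_eigen.zero)
next
  case v: (step v c)
  have c: "c \<in> carrier K" using v C by auto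
  show ?case using v.prems
  proof (induction rule: gen_eigen.induct)
    case zero
    then show ?case using v by (simp add: gen_eigen.zero)
  next
    case w: (step w d)
    have d: "d \<in> carrier K" using w C by auto
    have "bracket L x (bracket L v w) \<oplus>\<^bsub>L\<^esub> (c \<oplus>\<^bsub>K\<^esub> d) \<odot>\<^bsub>L\<^esub> bracket L v w
        = bracket L (bracket L x v \<oplus>\<^bsub>L\<^esub> c \<odot>\<^bsub>L\<^esub> v) w \<oplus>\<^bsub>L\<^esub> bracket L v (bracket L x w \<oplus>\<^bsub>L\<^esub> d \<odot>\<^bsub>L\<^esub> w)"
      using x c d v(1) w(1) by (simp add: bracket_derivation[of x v w] bracket_add_left bracket_add_right
        bracket_smult_left bracket_smult_right smult_l_distr M.a_ac)
    moreover have "w \<in> gen_eigen x C" using w by - (rule gen_eigen.step[of w d])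
    ultimately show ?case using v w c d add
      by - (rule gen_eigen.step[of _ "c \<oplus>\<^bsub>K\<^esub> d"], auto intro: gen_eigen_add)
  qed
qed

lemma gen_eigen_subalgebra:
  assumes "\<And>c d. c \<in> C \<Longrightarrow> d \<in> C \<Longrightarrow> c \<oplus>\<^bsub>K\<^esub> d \<in> C"
  shows "lie_subalgebra K L (gen_eigen x C)"
  unfolding lie_subalgebra_def
proof (intro conjI ballI)
  show "VectorSpace.subspace K (gen_eigen x C) L"
    by (rule subspaceI) (auto intro: gen_eigen_closed gen_eigen.zero gen_eigen_add gen_eigen_smult)
qed (use assms gen_eigen_bracket in auto)

end

text \<open>Follow the chain that takes \<open>v\<close> to zero. It must enter \<open>I\<close>,
  and the member just before it first does so is the desired eigenvector modulo \<open>I\<close>;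
  \<open>W\<close> holds a property that survives along the chain.\<close>

lemma gen_eigen_minimal:
  assumes "v \<in> gen_eigen x C" "v \<in> W" "v \<notin> I" "\<zero>\<^bsub>L\<^esub> \<in> I"
    and "\<And>w c. w \<in> W \<Longrightarrow> c \<in> C \<Longrightarrow> bracket L x w \<oplus>\<^bsub>L\<^esub> c \<odot>\<^bsub>L\<^esub> w \<in> W"
  obtains w c where "w \<in> W" "w \<notin> I" "c \<in> C" "bracket L x w \<oplus>\<^bsub>L\<^esub> c \<odot>\<^bsub>L\<^esub> w \<in> I"
  using assms(1-3)
proof (induction arbitrary: thesis rule: gen_eigen.induct)
  case (step v c)
  then show thesis using assms(5) by (cases "bracket L x v \<oplus>\<^bsub>L\<^esub> c \<odot>\<^bsub>L\<^esub> v \<in> I") auto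
qed (use assms in auto)

lemma gen_eigen_zero_step:
  "\<lbrakk>x \<in> carrier L; v \<in> carrier L; bracket L x v \<in> gen_eigen x {\<zero>\<^bsub>K\<^esub>}\<rbrakk> \<Longrightarrow> v \<in> gen_eigen x {\<zero>\<^bsub>K\<^esub>}"
  by - (rule gen_eigen.step[of v "\<zero>\<^bsub>K\<^esub>"], auto)

text \<open>For the eigenvalue zero alone this is the Fitting null component. The description by
  iterates involves the bracket only, so it can be carried over between \<open>L\<close> and an
  ideal with restricted carrier.\<close>

lemma gen_eigen_zero_iff:
  assumes x: "x \<in> carrier L"
  shows "v \<in> gen_eigen x {\<zero>\<^bsub>K\<^esub>} \<longleftrightarrow> v \<in> carrier L \<and> (\<exists>m. (bracket L x ^^ m) v = \<zero>\<^bsub>L\<^esub>)"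
proof (intro iffI conjI)
  assume "v \<in> gen_eigen x {\<zero>\<^bsub>K\<^esub>}"
  then show "\<exists>m. (bracket L x ^^ m) v = \<zero>\<^bsub>L\<^esub>"
  proof (induction rule: gen_eigen.induct)
    case zero
    have "(bracket L x ^^ 0) \<zero>\<^bsub>L\<^esub> = \<zero>\<^bsub>L\<^esub>" by simp
    then show ?case by blast
  next
    case (step v c)
    then obtain m where "(bracket L x ^^ m) (bracket L x v) = \<zero>\<^bsub>L\<^esub>" using x by auto
    then have "(bracket L x ^^ Suc m) v = \<zero>\<^bsub>L\<^esub>" by (simp add: funpow_swap1)
    then show ?case by blast
  qed
next
  assume v: "v \<in> carrier L \<and> (\<exists>m. (bracket L x ^^ m) v = \<zero>\<^bsub>L\<^esub>)"
  then obtain m where "(bracket L x ^^ m) v = \<zero>\<^bsub>L\<^esub>" by blast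
  with conjunct1[OF v] show "v \<in> gen_eigen x {\<zero>\<^bsub>K\<^esub>}"
  proof (induction m arbitrary: v)
    case (Suc m)
    have "bracket L x v \<in> gen_eigen x {\<zero>\<^bsub>K\<^esub>}"
      by (rule Suc.IH) (use Suc.prems x in \<open>auto simp: funpow_swap1\<close>)
    then show ?case using gen_eigen_zero_step x Suc.prems by blast
  qed (simp add: gen_eigen.zero)
qed (rule gen_eigen_closed)

text \<open>A Fitting decomposition: \<open>T ^^ m\<close> is idempotent on \<open>y\<close> for some \<open>m > 0\<close>, because the carrier is finite.\<close>

lemma fitting_sum:
  assumes fin: "finite (carrier L)"
    and T: "T \<in> carrier L \<rightarrow> P" and P: "P \<subseteq> carrier L"
    and add: "\<And>u v. u \<in> carrier L \<Longrightarrow> v \<in> carrier L \<Longrightarrow> T (u \<oplus>\<^bsub>L\<^esub> v) = T u \<oplus>\<^bsub>L\<^esub> T v"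
    and G: "\<zero>\<^bsub>L\<^esub> \<in> G" "\<And>z. z \<in> carrier L \<Longrightarrow> T z \<in> G \<Longrightarrow> z \<in> G"
    and y: "y \<in> carrier L"
  shows "\<exists>z\<in>G. \<exists>w\<in>P. y = z \<oplus>\<^bsub>L\<^esub> w"
proof -
  have TL: "T \<in> carrier L \<rightarrow> carrier L" using T P by auto
  have cl: "(T ^^ i) v \<in> carrier L" if "v \<in> carrier L" for i v
    using that TL by (induction i) auto
  have pow_add: "(T ^^ i) (u \<oplus>\<^bsub>L\<^esub> v) = (T ^^ i) u \<oplus>\<^bsub>L\<^esub> (T ^^ i) v"
    if "u \<in> carrier L" "v \<in> carrier L" for i u v
    using that cl by (induction i) (auto simp: add)
  have pow_G: "z \<in> G" if "z \<in> carrier L" "(T ^^ i) z \<in> G" for i z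
    using that cl G(2) by (induction i) auto
  obtain m where m: "m > 0" "(T ^^ (m + m)) y = (T ^^ m) y"
    using funpow_eventually_periodic[OF fin TL y] by blast
  \<comment> \<open>The decomposition is \<open>y = (y - w) + w\<close>. Since \<open>m > 0\<close>,
    \<open>w\<close> is a value of \<open>T\<close> and lies in \<open>P\<close>; since
    \<open>T ^^ m\<close> fixes \<open>w\<close>, it kills \<open>y - w\<close>.\<close>
  define w where "w = (T ^^ m) y"
  have w: "w \<in> carrier L" "(T ^^ m) w = w" using cl y m by (auto simp: w_def funpow_add)
  have "w \<in> P" using m(1) T cl[OF y, of "m - 1"] by (cases m) (auto simp: w_def)
  have yw: "y = (y \<ominus>\<^bsub>L\<^esub> w) \<oplus>\<^bsub>L\<^esub> w" using y w by (simp add: a_minus_def M.a_assoc M.l_neg)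
  have "w = (T ^^ m) (y \<ominus>\<^bsub>L\<^esub> w) \<oplus>\<^bsub>L\<^esub> w"
    using pow_add[of "y \<ominus>\<^bsub>L\<^esub> w" w m] w y yw by (simp flip: w_def)
  then have "(T ^^ m) (y \<ominus>\<^bsub>L\<^esub> w) = \<zero>\<^bsub>L\<^esub>"
    using w y cl[of "y \<ominus>\<^bsub>L\<^esub> w" m] by (metis M.add.r_cancel_one' M.minus_closed)
  then have "y \<ominus>\<^bsub>L\<^esub> w \<in> G" using pow_G[of "y \<ominus>\<^bsub>L\<^esub> w" m] G(1) y w by simp
  then show ?thesis using yw \<open>w \<in> P\<close> by blast
qed

text \<open>The Frattini subalgebra consists of nongenerators: a proper \<open>S\<close> would lie
  in a maximal subalgebra, which also contains \<open>P\<close> and therefore every sum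
  \<open>z + w\<close>.\<close>

lemma lie_subalgebra_supplement:
  assumes fin: "finite (carrier L)" and S: "lie_subalgebra K L S"
    and P: "P \<subseteq> frattini_subalgebra K L"
    and sum: "\<And>y. y \<in> carrier L \<Longrightarrow> \<exists>z\<in>S. \<exists>w\<in>P. y = z \<oplus>\<^bsub>L\<^esub> w"
  shows "S = carrier L"
proof (rule ccontr)
  assume "S \<noteq> carrier L"
  let ?A = "{M. lie_subalgebra K L M \<and> S \<subseteq> M \<and> M \<noteq> carrier L}"
  have "?A \<subseteq> Pow (carrier L)" using subspaceD(1) lie_subalgebra_subspace by blast
  then have "finite ?A" using fin by (simp add: finite_subset)
  moreover have "S \<in> ?A" using S \<open>S \<noteq> carrier L\<close> by simp
  ultimately obtain M where M: "M \<in> ?A" and max: "\<forall>T\<in>?A. M \<subseteq> T \<longrightarrow> M = T"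
    by (rule finite_maximal_set)
  then have "maximal_subalgebra K L M" unfolding maximal_subalgebra_def by blast
  then have "P \<subseteq> M" using P by (auto simp: frattini_subalgebra_def)
  have "carrier L \<subseteq> M"
  proof
    fix y assume "y \<in> carrier L"
    then obtain z w where "z \<in> S" "w \<in> P" "y = z \<oplus>\<^bsub>L\<^esub> w" using sum by blast
    then show "y \<in> M" using M \<open>P \<subseteq> M\<close> subspaceD(4)[OF lie_subalgebra_subspace, of M z w] by auto
  qed
  then show False using M subspaceD(1)[OF lie_subalgebra_subspace, of M] by blast
qed


section \<open>Engel's theorem and flags of ideals\<close>

text \<open>Engel's theorem for the action of \<open>H\<close> on \<open>U / I\<close>, with pairs
  of subspaces in place of quotients. A subalgebra \<open>M\<close> of \<open>H\<close> that is
  maximal with this property must be \<open>H\<close>, since otherwise it could be enlarged by an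
  element of \<open>H\<close> normalising it.\<close>

lemma engel_common_kernel:
  assumes fin: "finite (carrier L)" and H: "lie_subalgebra K L H"
    and nil: "\<And>a. a \<in> H \<Longrightarrow> gen_eigen a {\<zero>\<^bsub>K\<^esub>} = carrier L"
    and "VectorSpace.subspace K I L" "VectorSpace.subspace K U L" "I \<subset> U"
    and "\<And>a v. a \<in> H \<Longrightarrow> v \<in> I \<Longrightarrow> bracket L a v \<in> I"
    and "\<And>a v. a \<in> H \<Longrightarrow> v \<in> U \<Longrightarrow> bracket L a v \<in> U"
  shows "\<exists>w\<in>U - I. \<forall>a\<in>H. bracket L a w \<in> I"
proof -
  \<comment> \<open>Quantified over all pairs, because the property of \<open>M\<close> is used both
    for \<open>M \<subset> H\<close> and for an arbitrary pair \<open>I \<subset> U\<close>.\<close>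
  define engel where "engel M \<longleftrightarrow> (\<forall>I U. VectorSpace.subspace K I L \<longrightarrow> VectorSpace.subspace K U L \<longrightarrow>
    I \<subset> U \<longrightarrow> (\<forall>a\<in>M. \<forall>v\<in>I. bracket L a v \<in> I) \<longrightarrow> (\<forall>a\<in>M. \<forall>v\<in>U. bracket L a v \<in> U) \<longrightarrow>
    (\<exists>w\<in>U - I. \<forall>a\<in>M. bracket L a w \<in> I))" for M
  let ?A = "{M. lie_subalgebra K L M \<and> M \<subseteq> H \<and> engel M}"
  have HL: "H \<subseteq> carrier L" using subspaceD(1)[OF lie_subalgebra_subspace[OF H]] .
  have "finite H" using HL fin by (rule finite_subset)
  then have "finite ?A" by (intro finite_subset[of ?A "Pow H"]) auto
  moreover have "{\<zero>\<^bsub>L\<^esub>} \<in> ?A"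
  proof -
    have "engel {\<zero>\<^bsub>L\<^esub>}" unfolding engel_def
    proof (intro allI impI)
      fix I U assume IU: "VectorSpace.subspace K I L" "VectorSpace.subspace K U L" "I \<subset> U"
      then obtain w where w: "w \<in> U - I" by blast
      moreover have "bracket L \<zero>\<^bsub>L\<^esub> w \<in> I" using w subspaceD(2)[OF IU(2)] subspaceD(3)[OF IU(1)] by simp
      ultimately show "\<exists>w\<in>U - I. \<forall>a\<in>{\<zero>\<^bsub>L\<^esub>}. bracket L a w \<in> I" by auto
    qed
    then show ?thesis using lie_subalgebra_zero subspaceD(3)[OF lie_subalgebra_subspace[OF H]] by simp
  qed
  ultimately obtain M where "M \<in> ?A" and max0: "\<forall>T\<in>?A. M \<subseteq> T \<longrightarrow> M = T"
    by (rule finite_maximal_set)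
  note max = max0[rule_format]
  have M: "lie_subalgebra K L M" "M \<subseteq> H" "engel M" using \<open>M \<in> ?A\<close> by auto
  note Ms = lie_subalgebra_subspace[OF M(1)]
  have "M = H"
  proof (rule ccontr)
    assume "M \<noteq> H"
    then have "M \<subset> H" using M(2) by blast
    moreover have "\<forall>a\<in>M. \<forall>v\<in>M. bracket L a v \<in> M" "\<forall>a\<in>M. \<forall>v\<in>H. bracket L a v \<in> H"
      using M H by (auto simp: lie_subalgebra_def)
    \<comment> \<open>The property of \<open>M\<close>, applied to its action on
      \<open>H / M\<close>, gives an element outside \<open>M\<close> that normalises
      \<open>M\<close>.\<close>
    ultimately obtain x where x: "x \<in> H" "x \<notin> M" and xM: "\<And>a. a \<in> M \<Longrightarrow> bracket L a x \<in> M"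
      using M(3)[unfolded engel_def, rule_format, OF Ms lie_subalgebra_subspace[OF H]] by blast
    have xL: "x \<in> carrier L" using x HL by blast
    have M_in: "a \<in> carrier L" if "a \<in> M" for a using that M(2) HL by blast
    have Mx: "bracket L x a \<in> M" if "a \<in> M" for a
      using xM[OF that] bracket_antisym[OF xL M_in[OF that]] subspace_uminus[OF Ms] by simp
    let ?M = "adjoin M x"
    note ad = adjoin_subspace[OF Ms xL] subset_adjoin[OF Ms xL] mem_adjoin[OF Ms xL]
    have "lie_subalgebra K L ?M" unfolding lie_subalgebra_def
    proof (intro conjI ballI ad(1))
      fix a b assume "a \<in> ?M" "b \<in> ?M"
      then obtain u c u' c' where *: "u \<in> M" "c \<in> carrier K" "u' \<in> M" "c' \<in> carrier K"
        and ab: "a = u \<oplus>\<^bsub>L\<^esub> c \<odot>\<^bsub>L\<^esub> x" "b = u' \<oplus>\<^bsub>L\<^esub> c' \<odot>\<^bsub>L\<^esub> x" by (auto elim!: adjoinE)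
      have "bracket L a b = bracket L u u' \<oplus>\<^bsub>L\<^esub> (c' \<odot>\<^bsub>L\<^esub> bracket L u x \<oplus>\<^bsub>L\<^esub> c \<odot>\<^bsub>L\<^esub> bracket L x u')"
        using * M_in xL by (simp add: ab bracket_add_left bracket_add_right bracket_smult_left
          bracket_smult_right M.a_ac)
      then have "bracket L a b \<in> M"
        using * xM Mx M(1) subspaceD(4,5)[OF Ms] by (simp add: lie_subalgebra_def)
      then show "bracket L a b \<in> ?M" using ad(2) by blast
    qed
    moreover have "?M \<subseteq> H" using adjoin_subset[OF lie_subalgebra_subspace[OF H] M(2) x(1)] .
    moreover have "engel ?M" unfolding engel_def
    proof (intro allI impI)
      fix I U
      assume I: "VectorSpace.subspace K I L" and U: "VectorSpace.subspace K U L" and IU: "I \<subset> U"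
        and invI: "\<forall>a\<in>?M. \<forall>v\<in>I. bracket L a v \<in> I" and invU: "\<forall>a\<in>?M. \<forall>v\<in>U. bracket L a v \<in> U"
      \<comment> \<open>The vectors killed by \<open>M\<close> modulo \<open>I\<close>. As
        \<open>x\<close> normalises \<open>M\<close>, \<open>ad x\<close> preserves
        \<open>W\<close>, and a vector of \<open>W\<close> outside \<open>I\<close> that
        \<open>ad x\<close> sends into \<open>I\<close> is killed by all of \<open>?M\<close> modulo
        \<open>I\<close>.\<close>
      define W where "W = {v \<in> U. \<forall>a\<in>M. bracket L a v \<in> I}"
      have "\<forall>a\<in>M. \<forall>v\<in>I. bracket L a v \<in> I" "\<forall>a\<in>M. \<forall>v\<in>U. bracket L a v \<in> U"
        using invI invU ad(2) by blast+
      then obtain v where v: "v \<in> W" "v \<notin> I"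
        using M(3)[unfolded engel_def, rule_format, OF I U IU] by (auto simp: W_def)
      note UL = subspaceD(2)[OF U]
      have "bracket L x w \<in> W" if "w \<in> W" for w
      proof -
        have w: "w \<in> U" "w \<in> carrier L" using that UL by (auto simp: W_def)
        have "bracket L a (bracket L x w) \<in> I" if a: "a \<in> M" for a
          using bracket_derivation[OF M_in[OF a] xL w(2)] a ad(3) invI xM[OF a] \<open>w \<in> W\<close>
            subspaceD(4)[OF I] by (auto simp: W_def)
        then show ?thesis using invU ad(3) w by (auto simp: W_def)
      qed
      then have Winv: "bracket L x w \<oplus>\<^bsub>L\<^esub> c \<odot>\<^bsub>L\<^esub> w \<in> W" if "w \<in> W" "c \<in> {\<zero>\<^bsub>K\<^esub>}" for w c
        using that UL xL by (auto simp: W_def)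
      have "v \<in> gen_eigen x {\<zero>\<^bsub>K\<^esub>}" using nil[OF x(1)] v UL by (auto simp: W_def)
      then obtain w c where w: "w \<in> W" "w \<notin> I" "c \<in> {\<zero>\<^bsub>K\<^esub>}" "bracket L x w \<oplus>\<^bsub>L\<^esub> c \<odot>\<^bsub>L\<^esub> w \<in> I"
        using gen_eigen_minimal[OF _ v subspaceD(3)[OF I] Winv] by blast
      have wL: "w \<in> carrier L" using w UL by (auto simp: W_def)
      then have xw: "bracket L x w \<in> I" using w xL by auto
      have "bracket L a w \<in> I" if "a \<in> ?M" for a
        using that
      proof (rule adjoinE)
        fix u b assume "u \<in> M" "b \<in> carrier K" "a = u \<oplus>\<^bsub>L\<^esub> b \<odot>\<^bsub>L\<^esub> x"
        then show ?thesis using w(1) xw wL xL M_in[of u] subspaceD(4,5)[OF I]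
          by (simp add: W_def bracket_add_left bracket_smult_left)
      qed
      then show "\<exists>w\<in>U - I. \<forall>a\<in>?M. bracket L a w \<in> I" using w by (auto simp: W_def)
    qed
    ultimately have "M = ?M" using ad(2) by (intro max) auto
    then show False using ad(3) x(2) by simp
  qed
  then show ?thesis using M(3)[unfolded engel_def, rule_format, of I U] assms(4-) by blast
qed

section \<open>The lower central series and nilpotency\<close>

lemma lie_product_subspace:
  assumes "A \<subseteq> carrier L" "B \<subseteq> carrier L"
  shows "VectorSpace.subspace K (lie_product K L A B) L"
  unfolding lie_product_def using assms by (intro span_is_subspace) auto

lemma bracket_in_lie_product:
  assumes "A \<subseteq> carrier L" "B \<subseteq> carrier L" "x \<in> A" "y \<in> B"
  shows "bracket L x y \<in> lie_product K L A B"
proof -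
  have "{bracket L x y |x y. x \<in> A \<and> y \<in> B} \<subseteq> carrier L" using assms by auto
  from in_own_span[OF this] show ?thesis unfolding lie_product_def using assms by blast
qed

lemma lie_product_subset:
  assumes "VectorSpace.subspace K W L" "\<And>x y. x \<in> A \<Longrightarrow> y \<in> B \<Longrightarrow> bracket L x y \<in> W"
  shows "lie_product K L A B \<subseteq> W"
  unfolding lie_product_def using assms by (intro span_is_subset is_module) auto

lemma lower_central_subspace: "VectorSpace.subspace K (lower_central K L i) L"
  by (induction i) (simp_all add: lie_product_subspace subspace_carrier subspaceD(1))

lemma lower_central_decreasing: "lower_central K L (Suc i) \<subseteq> lower_central K L i"
proof (induction i)
  case 0
  then show ?case using subspaceD(1)[OF lower_central_subspace[of "Suc 0"]] by simp
next
  case (Suc i)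
  note LC = subspaceD(1)[OF lower_central_subspace]
  have "lie_product K L (carrier L) (lower_central K L (Suc i))
      \<subseteq> lie_product K L (carrier L) (lower_central K L i)"
    using Suc LC[of i]
    by (intro lie_product_subset lie_product_subspace bracket_in_lie_product) auto
  then show ?case by simp
qed

text \<open>As long as a term of the series is nonzero, the next one is strictly smaller: it lies in
  a maximal invariant proper subspace of the term. Finiteness bounds the number of such
  drops.\<close>

lemma engel_nilpotent:
  assumes fin: "finite (carrier L)"
    and nil: "\<And>a. a \<in> carrier L \<Longrightarrow> gen_eigen a {\<zero>\<^bsub>K\<^esub>} = carrier L"
  shows "lie_nilpotent K L"
proof (rule ccontr)
  assume "\<not> lie_nilpotent K L"
  then have nz: "lower_central K L i \<noteq> {\<zero>\<^bsub>L\<^esub>}" for i by (simp add: lie_nilpotent_def)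
  have strict: "lower_central K L (Suc i) \<noteq> lower_central K L i" for i
  proof -
    let ?U = "lower_central K L i"
    have U: "VectorSpace.subspace K ?U L" by (rule lower_central_subspace)
    have Uinv: "bracket L a v \<in> ?U" if "a \<in> carrier L" "v \<in> ?U" for a v
      using bracket_in_lie_product[OF order_refl subspaceD(1)[OF U] that]
        lower_central_decreasing[of i] by auto
    let ?A = "{I. VectorSpace.subspace K I L \<and> I \<subset> ?U \<and> (\<forall>a\<in>carrier L. \<forall>v\<in>I. bracket L a v \<in> I)}"
    have "finite ?U" using fin subspaceD(1)[OF U] finite_subset by blast
    then have "finite ?A" by (intro finite_subset[of ?A "Pow ?U"]) auto
    moreover have "{\<zero>\<^bsub>L\<^esub>} \<in> ?A" using subspace_zero subspaceD(3)[OF U] nz[of i] by auto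
    ultimately obtain I where IA: "I \<in> ?A" and max0: "\<forall>T\<in>?A. I \<subseteq> T \<longrightarrow> I = T"
      by (rule finite_maximal_set)
    note max = max0[rule_format]
    have I: "VectorSpace.subspace K I L" "I \<subset> ?U" "\<And>a v. a \<in> carrier L \<Longrightarrow> v \<in> I \<Longrightarrow> bracket L a v \<in> I"
      using IA by auto
    obtain w where w: "w \<in> ?U" "w \<notin> I" "\<And>a. a \<in> carrier L \<Longrightarrow> bracket L a w \<in> I"
      using engel_common_kernel[OF fin lie_subalgebra_carrier nil I(1) U I(2) I(3) Uinv] by blast
    have wL: "w \<in> carrier L" using w subspaceD(2)[OF U] by blast
    have brI: "bracket L a v \<in> I" if "a \<in> carrier L" "v \<in> adjoin I w" for a v
      using that(2)
    proof (rule adjoinE)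
      fix u b assume "u \<in> I" "b \<in> carrier K" "v = u \<oplus>\<^bsub>L\<^esub> b \<odot>\<^bsub>L\<^esub> w"
      then show ?thesis using that(1) w(3) I(3) wL subspaceD(2,4,5)[OF I(1)]
        by (simp add: bracket_add_right bracket_smult_right)
    qed
    \<comment> \<open>Brackets with \<open>adjoin I w\<close> even fall into \<open>I\<close>, so
      this space is invariant and, being larger than \<open>I\<close>, must be all of
      \<open>?U\<close>.\<close>
    have "adjoin I w = ?U"
    proof (rule ccontr)
      assume "adjoin I w \<noteq> ?U"
      moreover have "adjoin I w \<subseteq> ?U" using adjoin_subset[OF U] I(2) w(1) by blast
      ultimately have "adjoin I w \<in> ?A"
        using brI subset_adjoin[OF I(1) wL] adjoin_subspace[OF I(1) wL] by auto
      then show False using max[of "adjoin I w"] subset_adjoin[OF I(1) wL] mem_adjoin[OF I(1) wL] w(2)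
        by blast
    qed
    then have "lower_central K L (Suc i) \<subseteq> I" using brI lie_product_subset[OF I(1)] by simp
    then show ?thesis using I(2) by blast
  qed
  \<comment> \<open>Every drop costs at least one element, so more than
    \<open>card (carrier L)\<close> drops are impossible.\<close>
  have "card (lower_central K L i) + i \<le> card (carrier L)" for i
  proof (induction i)
    case (Suc i)
    have "finite (lower_central K L i)"
      using fin subspaceD(1)[OF lower_central_subspace] finite_subset by blast
    then have "card (lower_central K L (Suc i)) < card (lower_central K L i)"
      using strict lower_central_decreasing by (intro psubset_card_mono) auto
    then show ?case using Suc by simp
  qed simp
  from this[of "Suc (card (carrier L))"] show False by simp
qed

text \<open>A vector killed by \<open>N\<close> modulo \<open>I\<close> and an eigenvector of \<open>x\<close> modulo \<open>I\<close> spans an ideal of \<open>L / I\<close>.\<close>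

lemma lie_ideal_extend:
  assumes fin: "finite (carrier L)" and N: "lie_ideal K L N"
    and nil: "\<And>a. a \<in> N \<Longrightarrow> gen_eigen a {\<zero>\<^bsub>K\<^esub>} = carrier L"
    and x: "x \<in> carrier L" "gen_eigen x (carrier K) = carrier L"
    and sum: "\<And>y. y \<in> carrier L \<Longrightarrow> \<exists>a\<in>N. \<exists>c\<in>carrier K. y = a \<oplus>\<^bsub>L\<^esub> c \<odot>\<^bsub>L\<^esub> x"
    and I: "lie_ideal K L I" "I \<noteq> carrier L"
  shows "\<exists>J. lie_ideal K L J \<and> I \<subset> J \<and> card J = card I * order K"
proof -
  note Is = lie_ideal_subspace[OF I(1)] and Ns = lie_ideal_subspace[OF N]
  \<comment> \<open>Engel's theorem makes \<open>W\<close> reach outside \<open>I\<close>. As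
    \<open>N\<close> is an ideal, \<open>W\<close> is stable under every \<open>ad x + c\<close>, so
    the chain of \<open>v\<close> under these operators stays in \<open>W\<close> and supplies an
    eigenvector of \<open>x\<close> modulo \<open>I\<close>.\<close>
  define W where "W = {v \<in> carrier L. \<forall>a\<in>N. bracket L a v \<in> I}"
  have "I \<subset> carrier L" using subspaceD(1)[OF Is] I(2) by blast
  then obtain v where v: "v \<in> W" "v \<notin> I"
    using engel_common_kernel[OF fin lie_ideal_subalgebra[OF N] nil Is subspace_carrier]
      lie_ideal_bracket_right[OF I(1)] subspaceD(2)[OF Ns] by (auto simp: W_def)
  have Winv: "bracket L x w \<oplus>\<^bsub>L\<^esub> c \<odot>\<^bsub>L\<^esub> w \<in> W" if "w \<in> W" "c \<in> carrier K" for w c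
  proof -
    have w: "w \<in> carrier L" using that by (simp add: W_def)
    have "bracket L a (bracket L x w \<oplus>\<^bsub>L\<^esub> c \<odot>\<^bsub>L\<^esub> w) \<in> I" if a: "a \<in> N" for a
    proof -
      have aL: "a \<in> carrier L" using a subspaceD(2)[OF Ns] by blast
      have "bracket L (bracket L a x) w \<in> I" "bracket L x (bracket L a w) \<in> I" "bracket L a w \<in> I"
        using lie_ideal_bracket_left[OF N x(1) a] lie_ideal_bracket_right[OF I(1) x(1)] \<open>w \<in> W\<close> a
        by (auto simp: W_def)
      then show ?thesis using aL w x(1) \<open>c \<in> carrier K\<close> subspaceD(4,5)[OF Is]
        by (simp add: bracket_add_right bracket_smult_right bracket_derivation[of a x w])
    qed
    then show ?thesis using w x(1) that(2) by (simp add: W_def)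
  qed
  have "v \<in> gen_eigen x (carrier K)" using v x(2) by (simp add: W_def)
  then obtain w c where w: "w \<in> W" "w \<notin> I" "c \<in> carrier K" "bracket L x w \<oplus>\<^bsub>L\<^esub> c \<odot>\<^bsub>L\<^esub> w \<in> I"
    using gen_eigen_minimal[OF _ v subspaceD(3)[OF Is] Winv] by blast
  have wL: "w \<in> carrier L" using w by (simp add: W_def)
  let ?J = "adjoin I w"
  note ad = adjoin_subspace[OF Is wL] subset_adjoin[OF Is wL] mem_adjoin[OF Is wL]
  have xw: "bracket L x w \<in> ?J"
    using w(3,4) ad subspace_add_right_cancel[OF ad(1), of "c \<odot>\<^bsub>L\<^esub> w" "bracket L x w"] x(1) wL
      subspaceD(5)[OF ad(1) w(3) ad(3)] by auto
  have "bracket L y w \<in> ?J" if y: "y \<in> carrier L" for y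
  proof -
    obtain a d where a: "a \<in> N" "d \<in> carrier K" "y = a \<oplus>\<^bsub>L\<^esub> d \<odot>\<^bsub>L\<^esub> x" using sum[OF y] by blast
    moreover have "bracket L a w \<in> ?J" using a(1) w(1) ad(2) by (auto simp: W_def)
    ultimately show ?thesis using xw x(1) wL subspaceD(2)[OF Ns a(1)] subspaceD(4,5)[OF ad(1)]
      by (simp add: bracket_add_left bracket_smult_left)
  qed
  note yw = this
  have "bracket L y v \<in> ?J" if "y \<in> carrier L" "v \<in> ?J" for y v
    using that(2)
  proof (rule adjoinE)
    fix u b assume u: "u \<in> I" "b \<in> carrier K" "v = u \<oplus>\<^bsub>L\<^esub> b \<odot>\<^bsub>L\<^esub> w"
    then have "bracket L y u \<in> ?J" using lie_ideal_bracket_right[OF I(1) that(1)] ad(2) by blast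
    then show ?thesis
      using u that(1) wL subspaceD(2)[OF Is] subspaceD(4,5)[OF ad(1)] yw
      by (simp add: bracket_add_right bracket_smult_right)
  qed
  then have "lie_ideal K L ?J" using ad(1) by (simp add: lie_ideal_def)
  moreover have "I \<subset> ?J" using ad(2,3) w(2) by blast
  ultimately show ?thesis using card_adjoin[OF Is wL w(2)] by blast
qed

text \<open>Iterate the extension from the zero ideal. The \<open>i\<close>-th ideal has
  \<open>order K ^ i\<close> elements, so it is proper for \<open>i < m\<close>, and for
  \<open>i = m\<close> it exhausts \<open>L\<close>.\<close>

lemma supersolvable_if_extendable:
  assumes finK: "finite (carrier K)" and fin: "finite (carrier L)"
    and ext: "\<And>I. lie_ideal K L I \<Longrightarrow> I \<noteq> carrier L \<Longrightarrow>
      \<exists>J. lie_ideal K L J \<and> I \<subset> J \<and> card J = card I * order K"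
  shows "supersolvable K L"
proof -
  have q: "1 < order K" by (rule order_gt_1[OF finK])
  \<comment> \<open>The choice is specified on proper ideals only; the iteration is followed only up
    to the index \<open>m\<close> at which \<open>L\<close> is reached.\<close>
  define ext_ideal where "ext_ideal I = (SOME J. lie_ideal K L J \<and> I \<subset> J \<and> card J = card I * order K)" for I
  define F where "F i = (ext_ideal ^^ i) {\<zero>\<^bsub>L\<^esub>}" for i
  have F0: "F 0 = {\<zero>\<^bsub>L\<^esub>}" by (simp add: F_def)
  define m where "m = local.dim"
  have cardL: "card (carrier L) = order K ^ m"
    using card_eq_power_dim(1)[OF fin_dim_if_finite[OF fin]] by (simp add: m_def)
  have step: "lie_ideal K L (F (Suc i)) \<and> F i \<subset> F (Suc i) \<and> card (F (Suc i)) = card (F i) * order K"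
    if "lie_ideal K L (F i)" "F i \<noteq> carrier L" for i
    using someI_ex[OF ext[OF that]] unfolding F_def ext_ideal_def by simp
  have F: "lie_ideal K L (F i) \<and> card (F i) = order K ^ i" if "i \<le> m" for i
    using that
  proof (induction i)
    case 0
    then show ?case using subspace_zero by (auto simp: F0 lie_ideal_def)
  next
    case (Suc i)
    then have "F i \<noteq> carrier L" using cardL q by auto
    then show ?case using Suc step[of i] by simp
  qed
  have ne: "F i \<noteq> carrier L" if "i < m" for i using F[of i] that cardL q by auto
  have "F m = carrier L"
    using F[of m] cardL fin subspaceD(1)[OF lie_ideal_subspace] by (intro card_subset_eq) auto
  moreover have "vectorspace.dim K (L\<lparr>carrier := F i\<rparr>) = i" if "i \<le> m" for i
    using subspace_card[OF finK fin lie_ideal_subspace, of "F i"] F[OF that] q by simp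
  ultimately show ?thesis
    unfolding supersolvable_def using F0 F step ne by (intro exI[of _ m] exI[of _ F]) auto
qed


section \<open>The Frattini ideal and Lie algebras all of whose subspaces are subalgebras\<close>

lemma lie_ideal_sum:
  assumes I: "lie_ideal K L I" and J: "lie_ideal K L J"
  shows "lie_ideal K L (subspace_sum I J)"
  unfolding lie_ideal_def
proof (intro conjI ballI)
  show "VectorSpace.subspace K (subspace_sum I J) L"
    using I J by (intro sum_is_subspace lie_ideal_subspace)
  fix x v assume x: "x \<in> carrier L" and "v \<in> subspace_sum I J"
  then obtain u w where uw: "u \<in> I" "w \<in> J" "v = u \<oplus>\<^bsub>L\<^esub> w" by (auto simp: submodule_sum_def)
  then have "bracket L x v = bracket L x u \<oplus>\<^bsub>L\<^esub> bracket L x w"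
    using x subspaceD(2)[OF lie_ideal_subspace] I J by (auto intro: bracket_add_right)
  moreover have "bracket L x u \<in> I" "bracket L x w \<in> J"
    using uw x I J lie_ideal_bracket_right by auto
  ultimately show "bracket L x v \<in> subspace_sum I J" by (auto simp: submodule_sum_def)
qed

lemma frattini_subalgebra_subspace: "VectorSpace.subspace K (frattini_subalgebra K L) L"
proof (rule subspaceI)
  have "VectorSpace.subspace K M L" if "maximal_subalgebra K L M" for M
    using that by (auto simp: maximal_subalgebra_def intro: lie_subalgebra_subspace)
  note D = subspaceD(3-5)[OF this]
  show "\<zero>\<^bsub>L\<^esub> \<in> frattini_subalgebra K L" using D(1) by (auto simp: frattini_subalgebra_def)
  show "x \<oplus>\<^bsub>L\<^esub> y \<in> frattini_subalgebra K L"
    if "x \<in> frattini_subalgebra K L" "y \<in> frattini_subalgebra K L" for x y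
    using that D(2) by (auto simp: frattini_subalgebra_def)
  show "a \<odot>\<^bsub>L\<^esub> x \<in> frattini_subalgebra K L"
    if "a \<in> carrier K" "x \<in> frattini_subalgebra K L" for a x
    using that D(3) by (auto simp: frattini_subalgebra_def)
qed (auto simp: frattini_subalgebra_def)

text \<open>The greatest element in the definition exists: a maximal ideal \<open>I\<close> inside
  the Frattini subalgebra absorbs any other such ideal \<open>J\<close>, because their sum is again
  one.\<close>

lemma frattini_ideal:
  assumes fin: "finite (carrier L)"
  shows "lie_ideal K L (frattini_ideal K L)" "frattini_ideal K L \<subseteq> frattini_subalgebra K L"
proof -
  let ?A = "{I. lie_ideal K L I \<and> I \<subseteq> frattini_subalgebra K L}"
  note F = frattini_subalgebra_subspace
  have "?A \<subseteq> Pow (carrier L)" using subspaceD(1)[OF lie_ideal_subspace] by auto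
  then have "finite ?A" using fin by (simp add: finite_subset)
  moreover have "{\<zero>\<^bsub>L\<^esub>} \<in> ?A" using subspaceD(3)[OF F] subspace_zero by (auto simp: lie_ideal_def)
  ultimately obtain I where I: "I \<in> ?A" and max: "\<forall>T\<in>?A. I \<subseteq> T \<longrightarrow> I = T"
    by (rule finite_maximal_set)
  have "frattini_ideal K L = I" unfolding frattini_ideal_def
  proof (rule Greatest_equality)
    show "lie_ideal K L I \<and> I \<subseteq> frattini_subalgebra K L" using I by simp
    fix J assume J: "lie_ideal K L J \<and> J \<subseteq> frattini_subalgebra K L"
    have sub: "VectorSpace.subspace K I L" "VectorSpace.subspace K J L"
      using I J by (auto intro: lie_ideal_subspace)
    have "subspace_sum I J \<subseteq> frattini_subalgebra K L"
      using vsum_is_minimal[OF sub F] I J by simp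
    then have "subspace_sum I J \<in> ?A" using I J lie_ideal_sum by simp
    then have "I = subspace_sum I J" using max in_sum_vs[OF sub] by blast
    then show "J \<le> I" using in_sum_vs[OF sub(2,1)] vsum_comm[OF sub] by simp
  qed
  then show "lie_ideal K L (frattini_ideal K L)" "frattini_ideal K L \<subseteq> frattini_subalgebra K L"
    using I by auto
qed

section \<open>Lie algebras in which every subspace is closed under the bracket\<close>

text \<open>The span of \<open>x\<close> and \<open>y\<close> is a subspace and hence a
  subalgebra.\<close>

lemma bracket_in_plane:
  assumes sub: "\<And>W. VectorSpace.subspace K W L \<Longrightarrow> lie_subalgebra K L W"
    and x: "x \<in> carrier L" and y: "y \<in> carrier L"
  shows "\<exists>a\<in>carrier K. \<exists>b\<in>carrier K. bracket L x y = a \<odot>\<^bsub>L\<^esub> x \<oplus>\<^bsub>L\<^esub> b \<odot>\<^bsub>L\<^esub> y"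
proof -
  note X = adjoin_subspace[OF subspace_zero x]
  let ?W = "adjoin (adjoin {\<zero>\<^bsub>L\<^esub>} x) y"
  have "lie_subalgebra K L ?W" by (rule sub[OF adjoin_subspace[OF X y]])
  moreover have "x \<in> ?W" "y \<in> ?W"
    using mem_adjoin[OF subspace_zero x] subset_adjoin[OF X y] mem_adjoin[OF X y] by auto
  ultimately have "bracket L x y \<in> ?W" by (simp add: lie_subalgebra_def)
  then obtain u b where "u \<in> adjoin {\<zero>\<^bsub>L\<^esub>} x" and b: "b \<in> carrier K"
    "bracket L x y = u \<oplus>\<^bsub>L\<^esub> b \<odot>\<^bsub>L\<^esub> y" by (rule adjoinE)
  then obtain a where "a \<in> carrier K" "u = a \<odot>\<^bsub>L\<^esub> x" using x by (auto elim!: adjoinE)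
  then show ?thesis using b by blast
qed

text \<open>As \<open>[x, x] = 0\<close>, \<open>ad x\<close> multiplies \<open>[x, y]\<close> by
  \<open>b\<close>; the witness is \<open>x\<close> divided by \<open>b\<close>.\<close>

lemma eigenvector_if_bracket_in_plane:
  assumes x: "x \<in> carrier L" and y: "y \<in> carrier L" and ab: "a \<in> carrier K" "b \<in> carrier K" "b \<noteq> \<zero>\<^bsub>K\<^esub>"
    and z: "bracket L x y = a \<odot>\<^bsub>L\<^esub> x \<oplus>\<^bsub>L\<^esub> b \<odot>\<^bsub>L\<^esub> y"
  shows "\<exists>w\<in>carrier L. bracket L w (bracket L x y) = bracket L x y"
proof -
  have b: "b \<in> Units K" using ab field_Units by auto
  have "bracket L (inv\<^bsub>K\<^esub> b \<odot>\<^bsub>L\<^esub> x) (bracket L x y) = inv\<^bsub>K\<^esub> b \<odot>\<^bsub>L\<^esub> bracket L x (a \<odot>\<^bsub>L\<^esub> x \<oplus>\<^bsub>L\<^esub> b \<odot>\<^bsub>L\<^esub> y)"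
    using b x y ab by (simp add: bracket_smult_left flip: z)
  also have "bracket L x (a \<odot>\<^bsub>L\<^esub> x \<oplus>\<^bsub>L\<^esub> b \<odot>\<^bsub>L\<^esub> y) = b \<odot>\<^bsub>L\<^esub> bracket L x y"
    using x y ab by (simp add: bracket_add_right bracket_smult_right)
  also have "inv\<^bsub>K\<^esub> b \<odot>\<^bsub>L\<^esub> (b \<odot>\<^bsub>L\<^esub> bracket L x y) = bracket L x y"
    using b x y ab by (simp flip: smult_assoc1)
  finally show ?thesis using b x by blast
qed

text \<open>A nonzero bracket yields \<open>x\<close> and \<open>z \<noteq> 0\<close> with
  \<open>[x, z] = z\<close>. Comparing \<open>[x, y]\<close> with \<open>[x, y + z]\<close> shows
  that \<open>ad x\<close> is the identity modulo the line of \<open>x\<close>, so \<open>x\<close>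
  and the vectors fixed by \<open>ad x\<close> span everything. Two fixed vectors \<open>a\<close>,
  \<open>b\<close> commute: \<open>[a, b]\<close> lies in their span and is fixed by
  \<open>ad x\<close>, yet the derivation rule doubles it.\<close>

lemma all_subspaces_subalgebras_cases [consumes 1]:
  assumes all: "\<forall>W. VectorSpace.subspace K W L \<longrightarrow> lie_subalgebra K L W"
  obtains (abelian) "\<And>x y. x \<in> carrier L \<Longrightarrow> y \<in> carrier L \<Longrightarrow> bracket L x y = \<zero>\<^bsub>L\<^esub>"
  | (almost_abelian) x z where "x \<in> carrier L" "z \<in> carrier L" "z \<noteq> \<zero>\<^bsub>L\<^esub>" "bracket L x z = z"
    "\<And>y. y \<in> carrier L \<Longrightarrow> \<exists>a\<in>carrier L. \<exists>c\<in>carrier K. bracket L x a = a \<and> y = a \<oplus>\<^bsub>L\<^esub> c \<odot>\<^bsub>L\<^esub> x"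
    "\<And>a b. \<lbrakk>a \<in> carrier L; b \<in> carrier L; bracket L x a = a; bracket L x b = b\<rbrakk> \<Longrightarrow> bracket L a b = \<zero>\<^bsub>L\<^esub>"
proof (cases "\<forall>x\<in>carrier L. \<forall>y\<in>carrier L. bracket L x y = \<zero>\<^bsub>L\<^esub>")
  case True
  then show thesis using abelian by blast
next
  case False
  have sub: "lie_subalgebra K L W" if "VectorSpace.subspace K W L" for W using all that by blast
  from False obtain x0 y0 where xy0: "x0 \<in> carrier L" "y0 \<in> carrier L" "bracket L x0 y0 \<noteq> \<zero>\<^bsub>L\<^esub>" by blast
  have "\<exists>x\<in>carrier L. \<exists>z\<in>carrier L. z \<noteq> \<zero>\<^bsub>L\<^esub> \<and> bracket L x z = z"
  proof -
    obtain a b where ab: "a \<in> carrier K" "b \<in> carrier K"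
      and z: "bracket L x0 y0 = a \<odot>\<^bsub>L\<^esub> x0 \<oplus>\<^bsub>L\<^esub> b \<odot>\<^bsub>L\<^esub> y0"
      using bracket_in_plane[OF sub xy0(1,2)] by blast
    show ?thesis
    proof (cases "b = \<zero>\<^bsub>K\<^esub>")
      case False
      then show ?thesis
        using eigenvector_if_bracket_in_plane[OF xy0(1,2) ab _ z] xy0 by auto
    next
      \<comment> \<open>Here the bracket is a multiple of \<open>x0\<close>; exchanging
        \<open>x0\<close> and \<open>y0\<close> moves the nonzero coefficient to the second
        argument.\<close>
      case True
      then have z': "bracket L x0 y0 = a \<odot>\<^bsub>L\<^esub> x0" using z xy0 ab by simp
      have ne: "bracket L y0 x0 \<noteq> \<zero>\<^bsub>L\<^esub>"
        using xy0 bracket_antisym[of x0 y0] by auto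
      have "bracket L y0 x0 = \<zero>\<^bsub>K\<^esub> \<odot>\<^bsub>L\<^esub> y0 \<oplus>\<^bsub>L\<^esub> (\<ominus>\<^bsub>K\<^esub> a) \<odot>\<^bsub>L\<^esub> x0"
        using bracket_antisym[of y0 x0] z' xy0 ab by (simp add: smult_l_minus)
      moreover have "\<ominus>\<^bsub>K\<^esub> a \<noteq> \<zero>\<^bsub>K\<^esub>" using z' xy0 ab by (metis R.minus_minus R.minus_zero smult_l_null)
      ultimately show ?thesis
        using eigenvector_if_bracket_in_plane[OF xy0(2,1), of "\<zero>\<^bsub>K\<^esub>" "\<ominus>\<^bsub>K\<^esub> a"] xy0 ab ne by auto
    qed
  qed
  then obtain x z where x: "x \<in> carrier L" and z: "z \<in> carrier L" "z \<noteq> \<zero>\<^bsub>L\<^esub>" "bracket L x z = z" by blast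
  define X where "X = adjoin {\<zero>\<^bsub>L\<^esub>} x"
  have X: "VectorSpace.subspace K X L" unfolding X_def by (rule adjoin_subspace[OF subspace_zero x])
  have XI: "c \<odot>\<^bsub>L\<^esub> x \<in> X" if "c \<in> carrier K" for c
    using adjoinI[of "\<zero>\<^bsub>L\<^esub>" "{\<zero>\<^bsub>L\<^esub>}" c x] that x by (simp add: X_def)
  have XE: "\<exists>c\<in>carrier K. u = c \<odot>\<^bsub>L\<^esub> x" if "u \<in> X" for u
    using that x by (auto simp: X_def elim!: adjoinE)
  have zX: "z \<notin> X"
  proof
    assume "z \<in> X"
    then obtain c where "c \<in> carrier K" "z = c \<odot>\<^bsub>L\<^esub> x" using XE by blast
    then show False using z x by (simp add: bracket_smult_right)
  qed
  let ?Z = "adjoin X z"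
  have Z: "VectorSpace.subspace K ?Z L" by (rule adjoin_subspace[OF X z(1)])
  have decomp: "\<exists>a\<in>carrier L. \<exists>c\<in>carrier K. bracket L x a = a \<and> y = a \<oplus>\<^bsub>L\<^esub> c \<odot>\<^bsub>L\<^esub> x"
    if y: "y \<in> carrier L" for y
  proof (cases "y \<in> ?Z")
    case True
    then obtain u d where "u \<in> X" "d \<in> carrier K" "y = u \<oplus>\<^bsub>L\<^esub> d \<odot>\<^bsub>L\<^esub> z" by (rule adjoinE)
    moreover from this obtain c where "c \<in> carrier K" "u = c \<odot>\<^bsub>L\<^esub> x" using XE by blast
    moreover have "bracket L x (d \<odot>\<^bsub>L\<^esub> z) = d \<odot>\<^bsub>L\<^esub> z"
      using \<open>d \<in> carrier K\<close> x z by (simp add: bracket_smult_right)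
    ultimately show ?thesis
      using x z by (intro bexI[of _ "d \<odot>\<^bsub>L\<^esub> z"] bexI[of _ c]) (auto simp: M.a_comm)
  next
    case False
    obtain a b where ab: "a \<in> carrier K" "b \<in> carrier K" "bracket L x y = a \<odot>\<^bsub>L\<^esub> x \<oplus>\<^bsub>L\<^esub> b \<odot>\<^bsub>L\<^esub> y"
      using bracket_in_plane[OF sub x y] by blast
    obtain a' b' where ab': "a' \<in> carrier K" "b' \<in> carrier K"
      "bracket L x (y \<oplus>\<^bsub>L\<^esub> z) = a' \<odot>\<^bsub>L\<^esub> x \<oplus>\<^bsub>L\<^esub> b' \<odot>\<^bsub>L\<^esub> (y \<oplus>\<^bsub>L\<^esub> z)"
      using bracket_in_plane[OF sub x, of "y \<oplus>\<^bsub>L\<^esub> z"] y z by auto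
    \<comment> \<open>Two expansions of \<open>[x, y + z]\<close> in the independent vectors
      \<open>x\<close>, \<open>z\<close>, \<open>y\<close>. The coefficient of \<open>y\<close>
      gives \<open>b = b'\<close>, that of \<open>z\<close> gives \<open>1 = b'\<close>.\<close>
    have "(a \<odot>\<^bsub>L\<^esub> x \<oplus>\<^bsub>L\<^esub> \<one>\<^bsub>K\<^esub> \<odot>\<^bsub>L\<^esub> z) \<oplus>\<^bsub>L\<^esub> b \<odot>\<^bsub>L\<^esub> y = bracket L x (y \<oplus>\<^bsub>L\<^esub> z)"
      using x y z ab(1,2) by (simp add: bracket_add_right ab(3) M.a_ac)
    also have "\<dots> = (a' \<odot>\<^bsub>L\<^esub> x \<oplus>\<^bsub>L\<^esub> b' \<odot>\<^bsub>L\<^esub> z) \<oplus>\<^bsub>L\<^esub> b' \<odot>\<^bsub>L\<^esub> y"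
      using x y z ab'(1,2) by (simp add: ab'(3) smult_r_distr M.a_ac)
    finally have "a \<odot>\<^bsub>L\<^esub> x \<oplus>\<^bsub>L\<^esub> \<one>\<^bsub>K\<^esub> \<odot>\<^bsub>L\<^esub> z = a' \<odot>\<^bsub>L\<^esub> x \<oplus>\<^bsub>L\<^esub> b' \<odot>\<^bsub>L\<^esub> z \<and> b = b'"
      using ab ab' XI by (intro adjoin_unique[OF Z y False]) (auto intro!: adjoinI)
    moreover from this have "a \<odot>\<^bsub>L\<^esub> x = a' \<odot>\<^bsub>L\<^esub> x \<and> \<one>\<^bsub>K\<^esub> = b'"
      using ab ab' XI by (intro adjoin_unique[OF X z(1) zX]) auto
    ultimately have "b = \<one>\<^bsub>K\<^esub>" by simp
    then have xy: "bracket L x y = a \<odot>\<^bsub>L\<^esub> x \<oplus>\<^bsub>L\<^esub> y" using ab y by simp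
    \<comment> \<open>\<open>ad x\<close> does not see the added multiple of \<open>x\<close>, which
      is chosen so that \<open>?a\<close> equals \<open>[x, y]\<close>; hence \<open>?a\<close> is
      fixed.\<close>
    let ?a = "a \<odot>\<^bsub>L\<^esub> x \<oplus>\<^bsub>L\<^esub> y"
    have "bracket L x ?a = ?a"
      using x y ab(1) by (simp add: bracket_add_right bracket_smult_right xy)
    moreover have "y = ?a \<oplus>\<^bsub>L\<^esub> (\<ominus>\<^bsub>K\<^esub> a) \<odot>\<^bsub>L\<^esub> x"
      using x y ab(1) by (simp add: smult_l_minus M.a_ac M.r_neg)
    moreover have "?a \<in> carrier L" "\<ominus>\<^bsub>K\<^esub> a \<in> carrier K" using x y ab(1) by auto
    ultimately show ?thesis by blast
  qed
  have comm: "bracket L a b = \<zero>\<^bsub>L\<^esub>"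
    if ab: "a \<in> carrier L" "b \<in> carrier L" "bracket L x a = a" "bracket L x b = b" for a b
  proof -
    obtain c d where cd: "c \<in> carrier K" "d \<in> carrier K" "bracket L a b = c \<odot>\<^bsub>L\<^esub> a \<oplus>\<^bsub>L\<^esub> d \<odot>\<^bsub>L\<^esub> b"
      using bracket_in_plane[OF sub ab(1,2)] by blast
    have "bracket L x (bracket L a b) = bracket L a b"
      using x ab cd(1,2) unfolding cd(3) by (simp add: bracket_add_right bracket_smult_right)
    moreover have "bracket L x (bracket L a b) = bracket L a b \<oplus>\<^bsub>L\<^esub> bracket L a b"
      using bracket_derivation[OF x ab(1,2)] ab by simp
    ultimately show ?thesis using ab by simp
  qed
  show thesis using almost_abelian[OF x z decomp comm] .
qed


section \<open>Lifting the structure of the Frattini quotient\<close>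

lemma lie_quotient_carrier: "carrier (lie_quotient L I) = (\<lambda>x. I +>\<^bsub>L\<^esub> x) ` carrier L"
  by (auto simp: lie_quotient_def A_RCOSETS_def')

lemma lie_quotient_add_rcos:
  assumes I: "lie_ideal K L I" and "x \<in> carrier L" "y \<in> carrier L"
  shows "I +>\<^bsub>L\<^esub> (x \<oplus>\<^bsub>L\<^esub> y) = (I +>\<^bsub>L\<^esub> x) \<oplus>\<^bsub>lie_quotient L I\<^esub> (I +>\<^bsub>L\<^esub> y)"
proof -
  interpret I: abelian_subgroup I L by (rule lie_ideal_abelian_subgroup[OF I])
  show ?thesis using assms by (simp add: lie_quotient_def I.a_rcos_sum)
qed

lemma rcos_eq_zero_iff:
  assumes I: "lie_ideal K L I" and x: "x \<in> carrier L"
  shows "I +>\<^bsub>L\<^esub> x = \<zero>\<^bsub>lie_quotient L I\<^esub> \<longleftrightarrow> x \<in> I"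
proof -
  interpret I: abelian_subgroup I L by (rule lie_ideal_abelian_subgroup[OF I])
  show ?thesis using I.a_rcos_const[of x] I.a_rcos_self[OF x] by (auto simp: lie_quotient_def)
qed

lemma rcos_eq_imp_add:
  assumes I: "lie_ideal K L I" and x: "x \<in> carrier L" "y \<in> carrier L" and eq: "I +>\<^bsub>L\<^esub> x = I +>\<^bsub>L\<^esub> y"
  shows "\<exists>w\<in>I. x = y \<oplus>\<^bsub>L\<^esub> w"
proof -
  interpret I: abelian_subgroup I L by (rule lie_ideal_abelian_subgroup[OF I])
  have "x \<in> I +>\<^bsub>L\<^esub> y" using I.a_rcos_self[OF x(1)] eq by simp
  then obtain w where "w \<in> I" "x = w \<oplus>\<^bsub>L\<^esub> y" unfolding a_r_coset_def' by blast
  then show ?thesis using x I.a_Hcarr M.a_comm by blast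
qed

lemma card_lie_quotient:
  assumes fin: "finite (carrier L)" and I: "lie_ideal K L I"
  shows "card (carrier (lie_quotient L I)) * card I = card (carrier L)"
proof -
  interpret I: abelian_subgroup I L by (rule lie_ideal_abelian_subgroup[OF I])
  show ?thesis
    using M.a_lagrange[OF fin I.additive_subgroup_axioms] by (simp add: lie_quotient_def order_def)
qed

lemma finite_lie_quotient: "finite (carrier L) \<Longrightarrow> finite (carrier (lie_quotient L I))"
  by (simp add: lie_quotient_carrier)

section \<open>Nilpotent action modulo the Frattini subalgebra\<close>

text \<open>Fitting's decomposition for the square of \<open>ad a\<close> writes \<open>L\<close> as
  the null component of \<open>ad a\<close> plus a part inside \<open>P\<close>, and the null
  component is a subalgebra. The square is what the almost abelian case requires: one bracket with
  \<open>a\<close> leads into \<open>N\<close>, the second into \<open>P\<close>.\<close>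

lemma gen_eigen_eq_carrier_mod_frattini:
  assumes fin: "finite (carrier L)" and P: "P \<subseteq> frattini_subalgebra K L"
    and a: "a \<in> carrier L" and T: "\<And>y. y \<in> carrier L \<Longrightarrow> bracket L a (bracket L a y) \<in> P"
  shows "gen_eigen a {\<zero>\<^bsub>K\<^esub>} = carrier L"
proof (rule lie_subalgebra_supplement[OF fin _ P])
  show "lie_subalgebra K L (gen_eigen a {\<zero>\<^bsub>K\<^esub>})" using a by (intro gen_eigen_subalgebra) auto
  fix y assume "y \<in> carrier L"
  then show "\<exists>z\<in>gen_eigen a {\<zero>\<^bsub>K\<^esub>}. \<exists>w\<in>P. y = z \<oplus>\<^bsub>L\<^esub> w"
    using a T P subspaceD(1)[OF frattini_subalgebra_subspace]
    by (intro fitting_sum[OF fin, of "\<lambda>y. bracket L a (bracket L a y)"])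
      (auto simp: bracket_add_right gen_eigen.zero dest!: gen_eigen_zero_step[rotated 2])
qed

lemma nilpotent_if_abelian_mod_frattini:
  assumes finK: "finite (carrier K)" and fin: "finite (carrier L)" and P: "P \<subseteq> frattini_subalgebra K L"
    and br: "\<And>x y. x \<in> carrier L \<Longrightarrow> y \<in> carrier L \<Longrightarrow> bracket L x y \<in> P"
  shows "lie_nilpotent K L" "supersolvable K L"
proof -
  have nil: "gen_eigen a {\<zero>\<^bsub>K\<^esub>} = carrier L" if "a \<in> carrier L" for a
    using gen_eigen_eq_carrier_mod_frattini[OF fin P that] br that by simp
  then show "lie_nilpotent K L" by (rule engel_nilpotent[OF fin])
  have id: "lie_ideal K L (carrier L)" by (simp add: lie_ideal_def subspace_carrier)
  \<comment> \<open>The flag is built by \<open>lie_ideal_extend\<close> with \<open>N = L\<close>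
    and \<open>x = 0\<close>; every vector is an eigenvector of \<open>ad 0\<close>.\<close>
  have "gen_eigen \<zero>\<^bsub>L\<^esub> (carrier K) = carrier L"
  proof (intro equalityI subsetI)
    fix v assume v: "v \<in> carrier L"
    show "v \<in> gen_eigen \<zero>\<^bsub>L\<^esub> (carrier K)"
      by (rule gen_eigen.step[of _ "\<zero>\<^bsub>K\<^esub>"]) (use v gen_eigen.zero in auto)
  qed (rule gen_eigen_closed)
  moreover have "\<exists>a\<in>carrier L. \<exists>c\<in>carrier K. y = a \<oplus>\<^bsub>L\<^esub> c \<odot>\<^bsub>L\<^esub> \<zero>\<^bsub>L\<^esub>" if "y \<in> carrier L" for y
    using that by (intro bexI[of _ y] bexI[of _ "\<zero>\<^bsub>K\<^esub>"]) auto
  ultimately have "\<exists>J. lie_ideal K L J \<and> I \<subset> J \<and> card J = card I * order K"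
    if "lie_ideal K L I" "I \<noteq> carrier L" for I
    using lie_ideal_extend[OF fin id nil M.zero_closed] that by blast
  then show "supersolvable K L" by (rule supersolvable_if_extendable[OF finK fin])
qed

text \<open>Engel's theorem inside \<open>N\<close>: an iterate of \<open>ad a\<close> that kills a
  vector of \<open>N\<close> in \<open>L\<close> kills it in \<open>N\<close> as well.\<close>

lemma lie_nilpotent_if_ad_nilpotent:
  assumes fin: "finite (carrier L)" and N: "lie_ideal K L N"
    and nil: "\<And>a. a \<in> N \<Longrightarrow> gen_eigen a {\<zero>\<^bsub>K\<^esub>} = carrier L"
  shows "lie_nilpotent K (L\<lparr>carrier := N\<rparr>)"
proof -
  interpret N: lie_algebra K "L\<lparr>carrier := N\<rparr>"
    by (rule lie_subalgebra_lie_algebra[OF lie_ideal_subalgebra[OF N]])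
  note NL = subspaceD(1,2)[OF lie_ideal_subspace[OF N]]
  show ?thesis
  proof (rule N.engel_nilpotent)
    show "finite (carrier (L\<lparr>carrier := N\<rparr>))" using fin NL(1) finite_subset by auto
    fix a assume "a \<in> carrier (L\<lparr>carrier := N\<rparr>)"
    then have a: "a \<in> N" by simp
    show "N.gen_eigen a {\<zero>\<^bsub>K\<^esub>} = carrier (L\<lparr>carrier := N\<rparr>)"
    proof (intro equalityI subsetI)
      fix v assume "v \<in> carrier (L\<lparr>carrier := N\<rparr>)"
      then have v: "v \<in> N" by simp
      then have "v \<in> gen_eigen a {\<zero>\<^bsub>K\<^esub>}" using nil[OF a] NL by auto
      then show "v \<in> N.gen_eigen a {\<zero>\<^bsub>K\<^esub>}"
        using gen_eigen_zero_iff[of a v] N.gen_eigen_zero_iff[of a v] NL a v by simp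
    qed (rule N.gen_eigen_closed)
  qed
qed

text \<open>The structure of the quotient is given through representatives in \<open>L\<close>.
  Everything rests on the preimage \<open>N\<close> of the vectors fixed by \<open>\<pi> x\<close>:
  \<open>L = N + K x\<close>, brackets within \<open>N\<close> fall into \<open>P\<close>, and
  \<open>N\<close> turns out to be both the derived algebra and the nilradical.\<close>

lemma almost_abelian_mod_frattini:
  fixes P
  defines "Q \<equiv> lie_quotient L P" and "\<pi> \<equiv> \<lambda>u. P +>\<^bsub>L\<^esub> u"
  assumes finK: "finite (carrier K)" and fin: "finite (carrier L)"
    and P: "lie_ideal K L P" "P \<subseteq> frattini_subalgebra K L"
    and x: "x \<in> carrier L" and z: "z \<in> carrier L" "z \<notin> P" "\<pi> (bracket L x z) = \<pi> z"
    and decomp: "\<And>y. y \<in> carrier L \<Longrightarrow>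
      \<exists>a\<in>carrier L. \<exists>c\<in>carrier K. \<pi> (bracket L x a) = \<pi> a \<and> y = a \<oplus>\<^bsub>L\<^esub> c \<odot>\<^bsub>L\<^esub> x"
    and comm: "\<And>a b. \<lbrakk>a \<in> carrier L; b \<in> carrier L; \<pi> (bracket L x a) = \<pi> a; \<pi> (bracket L x b) = \<pi> b\<rbrakk> \<Longrightarrow>
      bracket L a b \<in> P"
  shows "supersolvable K L" "lie_derived K L = nilradical K L" "codimension K L (lie_derived K L) = 1"
proof -
  interpret Q: lie_algebra K Q unfolding Q_def by (rule lie_quotient_lie_algebra[OF P(1)])
  have \<pi>_closed: "\<pi> u \<in> carrier Q" if "u \<in> carrier L" for u
    using that by (simp add: \<pi>_def Q_def lie_quotient_carrier)
  have \<pi>_add: "\<pi> (u \<oplus>\<^bsub>L\<^esub> v) = \<pi> u \<oplus>\<^bsub>Q\<^esub> \<pi> v" if "u \<in> carrier L" "v \<in> carrier L" for u v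
    using lie_quotient_add_rcos[OF P(1) that] by (simp add: \<pi>_def Q_def)
  have \<pi>_smult: "\<pi> (c \<odot>\<^bsub>L\<^esub> u) = c \<odot>\<^bsub>Q\<^esub> \<pi> u" if "c \<in> carrier K" "u \<in> carrier L" for c u
    using lie_quotient_smult_rcos[OF P(1) that] by (simp add: \<pi>_def Q_def)
  have \<pi>_bracket: "\<pi> (bracket L u v) = bracket Q (\<pi> u) (\<pi> v)" if "u \<in> carrier L" "v \<in> carrier L" for u v
    using lie_quotient_bracket_rcos[OF P(1) that] by (simp add: \<pi>_def Q_def)
  have \<pi>_zero: "\<pi> u = \<zero>\<^bsub>Q\<^esub> \<longleftrightarrow> u \<in> P" if "u \<in> carrier L" for u
    using rcos_eq_zero_iff[OF P(1) that] by (simp add: \<pi>_def Q_def)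
  note hom = \<pi>_closed \<pi>_add \<pi>_smult \<pi>_bracket
  note Ps = lie_ideal_subspace[OF P(1)]

  \<comment> \<open>The ideal above the fixed vectors of the quotient\<close>
  define N where "N = {a \<in> carrier L. \<pi> (bracket L x a) = \<pi> a}"
  have NL: "a \<in> carrier L" if "a \<in> N" for a
    using that by (simp add: N_def)
  have Nx: "bracket Q (\<pi> x) (\<pi> a) = \<pi> a" if "a \<in> N" for a
    using that \<pi>_bracket[OF x NL[OF that]] unfolding N_def by simp
  have N_iff: "a \<in> N \<longleftrightarrow> bracket Q (\<pi> x) (\<pi> a) = \<pi> a" if "a \<in> carrier L" for a
    using that x by (simp add: N_def \<pi>_bracket)
  have Ncomm: "bracket Q (\<pi> a) (\<pi> b) = \<zero>\<^bsub>Q\<^esub>" if "a \<in> N" "b \<in> N" for a b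
    using comm[of a b] that \<pi>_zero[of "bracket L a b"] by (simp add: N_def \<pi>_bracket)
  have dec: "\<exists>a\<in>N. \<exists>c\<in>carrier K. y = a \<oplus>\<^bsub>L\<^esub> c \<odot>\<^bsub>L\<^esub> x" if "y \<in> carrier L" for y
    using decomp[OF that] by (auto simp: N_def)
  \<comment> \<open>Modulo \<open>P\<close>, \<open>a\<close> commutes with \<open>N\<close> and
    \<open>x\<close> is the identity on \<open>N\<close>, so \<open>a + c x\<close> acts on
    \<open>N\<close> as the scalar \<open>c\<close>.\<close>
  have act: "bracket Q (\<pi> (a \<oplus>\<^bsub>L\<^esub> c \<odot>\<^bsub>L\<^esub> x)) (\<pi> b) = c \<odot>\<^bsub>Q\<^esub> \<pi> b"
    if "a \<in> N" "b \<in> N" "c \<in> carrier K" for a b c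
    using that x NL[of a] NL[of b] Nx[of b] Ncomm[of a b]
    by (simp add: hom Q.bracket_add_left Q.bracket_smult_left)
  \<comment> \<open>A fixed \<open>\<pi> x\<close> would equal
    \<open>[\<pi> x, \<pi> x] = 0\<close>, and then \<open>\<pi> z\<close>, which it fixes, would
    vanish.\<close>
  have xN: "x \<notin> N"
  proof
    assume "x \<in> N"
    then have "\<pi> x = \<zero>\<^bsub>Q\<^esub>" using Nx[of x] x by (simp add: \<pi>_closed)
    then have "\<pi> z = \<zero>\<^bsub>Q\<^esub>" using z x by (simp add: hom)
    then show False using \<pi>_zero z by simp
  qed
  have N: "lie_ideal K L N" unfolding lie_ideal_def
  proof (intro conjI ballI)
    show "VectorSpace.subspace K N L"
      by (rule subspaceI)
        (use x in \<open>auto simp: N_def bracket_add_right bracket_smult_right \<pi>_add \<pi>_smult\<close>)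
    fix y b assume y: "y \<in> carrier L" and b: "b \<in> N"
    then obtain a c where ac: "a \<in> N" "c \<in> carrier K" "y = a \<oplus>\<^bsub>L\<^esub> c \<odot>\<^bsub>L\<^esub> x" using dec by blast
    then have "\<pi> (bracket L y b) = c \<odot>\<^bsub>Q\<^esub> \<pi> b" using act b NL y by (simp add: \<pi>_bracket)
    then show "bracket L y b \<in> N"
      using y b NL[OF b] ac(2) x Nx[OF b] by (simp add: N_iff \<pi>_closed Q.bracket_smult_right)
  qed
  note Ns = lie_ideal_subspace[OF N]

  have nil: "gen_eigen a {\<zero>\<^bsub>K\<^esub>} = carrier L" if a: "a \<in> N" for a
  proof (rule gen_eigen_eq_carrier_mod_frattini[OF fin P(2) NL[OF a]])
    fix y assume "y \<in> carrier L"
    then have "bracket L a y \<in> N" using lie_ideal_bracket_left[OF N] a by blast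
    then show "bracket L a (bracket L a y) \<in> P"
      using Ncomm[OF a] NL a \<pi>_zero[of "bracket L a (bracket L a y)"] by (simp add: \<pi>_bracket)
  qed

  \<comment> \<open>Triangularisability of \<open>ad x\<close> and supersolvability\<close>
  have "gen_eigen x (carrier K) = carrier L"
  proof (rule lie_subalgebra_supplement[OF fin _ P(2)])
    show "lie_subalgebra K L (gen_eigen x (carrier K))" using x by (intro gen_eigen_subalgebra) auto
    \<comment> \<open>This is \<open>(ad x)^2 - ad x\<close>. In the quotient \<open>ad x\<close> is
      a projection, sending \<open>a + c x\<close> to \<open>a\<close>, so \<open>?T\<close> maps
      into \<open>P\<close>.\<close>
    let ?T = "\<lambda>y. bracket L x (bracket L x y) \<oplus>\<^bsub>L\<^esub> (\<ominus>\<^bsub>K\<^esub> \<one>\<^bsub>K\<^esub>) \<odot>\<^bsub>L\<^esub> bracket L x y"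
    have T: "?T y \<in> P" if y: "y \<in> carrier L" for y
    proof -
      obtain a c where ac: "a \<in> N" "c \<in> carrier K" "y = a \<oplus>\<^bsub>L\<^esub> c \<odot>\<^bsub>L\<^esub> x" using dec[OF y] by blast
      then have "bracket L x y = bracket L x a"
        using x NL by (simp add: bracket_add_right bracket_smult_right)
      moreover have "bracket Q (\<pi> x) (\<pi> a) = \<pi> a" using Nx ac by simp
      ultimately have "\<pi> (?T y) = \<zero>\<^bsub>Q\<^esub>"
        using x ac(1) NL by (simp add: hom Q.smult_l_minus Q.M.r_neg)
      then show ?thesis using \<pi>_zero x y by simp
    qed
    \<comment> \<open>\<open>?T\<close> is \<open>ad x - 1\<close> after \<open>ad x\<close>, so it
      is undone by a step with \<open>c = -1\<close> followed by one with
      \<open>c = 0\<close>.\<close>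
    have T_eigen: "y \<in> gen_eigen x (carrier K)" if "y \<in> carrier L" "?T y \<in> gen_eigen x (carrier K)" for y
    proof -
      have "bracket L x y \<in> gen_eigen x (carrier K)"
        by (rule gen_eigen.step[of _ "\<ominus>\<^bsub>K\<^esub> \<one>\<^bsub>K\<^esub>"]) (use that x in auto)
      then show ?thesis
        using that x by - (rule gen_eigen.step[of _ "\<zero>\<^bsub>K\<^esub>"], auto)
    qed
    fix y assume "y \<in> carrier L"
    then show "\<exists>u\<in>gen_eigen x (carrier K). \<exists>w\<in>P. y = u \<oplus>\<^bsub>L\<^esub> w"
    proof (rule fitting_sum[OF fin _ subspaceD(1)[OF Ps] _ gen_eigen.zero T_eigen, of ?T, rotated 4])
      show "?T \<in> carrier L \<rightarrow> P" using T by auto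
    qed (use x in \<open>auto simp: bracket_add_right smult_r_distr M.a_ac\<close>)
  qed
  then show "supersolvable K L"
    using lie_ideal_extend[OF fin N nil x _ dec] by (intro supersolvable_if_extendable[OF finK fin]) blast

  \<comment> \<open>The derived algebra\<close>
  let ?D = "lie_derived K L"
  have D: "VectorSpace.subspace K ?D L" by (intro lie_product_subspace order_refl)
  have brD: "bracket L u v \<in> ?D" if "u \<in> carrier L" "v \<in> carrier L" for u v
    using bracket_in_lie_product[OF order_refl order_refl that] .
  have DN: "?D \<subseteq> N"
  proof (rule lie_product_subset[OF Ns])
    fix u v assume u: "u \<in> carrier L" and v: "v \<in> carrier L"
    obtain a c where ac: "a \<in> N" "c \<in> carrier K" "u = a \<oplus>\<^bsub>L\<^esub> c \<odot>\<^bsub>L\<^esub> x" using dec[OF u] by blast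
    obtain b d where bd: "b \<in> N" "d \<in> carrier K" "v = b \<oplus>\<^bsub>L\<^esub> d \<odot>\<^bsub>L\<^esub> x" using dec[OF v] by blast
    \<comment> \<open>As \<open>[x, x] = 0\<close>, only brackets with an entry in \<open>N\<close>
      survive the expansion.\<close>
    have "bracket L u v = bracket L u b \<oplus>\<^bsub>L\<^esub> d \<odot>\<^bsub>L\<^esub> bracket L a x"
      using ac bd x NL u by (simp add: bracket_add_right bracket_smult_right)
        (simp add: bracket_add_left bracket_smult_left)
    then show "bracket L u v \<in> N"
      using lie_ideal_bracket_right[OF N u bd(1)] lie_ideal_bracket_left[OF N x ac(1)]
        subspaceD(4,5)[OF Ns] bd(2) by simp
  qed
  \<comment> \<open>\<open>?D + K x\<close> contains all brackets and is thus a subalgebra. Together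
    with \<open>P\<close> it gives \<open>L\<close>, because \<open>a\<close> and
    \<open>[x, a]\<close> agree modulo \<open>P\<close> for \<open>a\<close> in
    \<open>N\<close>.\<close>
  have xD: "adjoin ?D x = carrier L"
  proof (rule lie_subalgebra_supplement[OF fin _ P(2)])
    have sub: "VectorSpace.subspace K (adjoin ?D x) L" by (rule adjoin_subspace[OF D x])
    then show "lie_subalgebra K L (adjoin ?D x)"
      unfolding lie_subalgebra_def using brD subset_adjoin[OF D x] subspaceD(2)[OF sub] by blast
    fix y assume "y \<in> carrier L"
    then obtain a c where ac: "a \<in> N" "c \<in> carrier K" "y = a \<oplus>\<^bsub>L\<^esub> c \<odot>\<^bsub>L\<^esub> x" using dec by blast
    have "\<pi> a = \<pi> (bracket L x a)" using ac(1) by (simp add: N_def)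
    then obtain w where w: "w \<in> P" "a = bracket L x a \<oplus>\<^bsub>L\<^esub> w"
      using rcos_eq_imp_add[OF P(1), of a "bracket L x a"] x NL ac(1) by (auto simp: \<pi>_def)
    have "y = (bracket L x a \<oplus>\<^bsub>L\<^esub> c \<odot>\<^bsub>L\<^esub> x) \<oplus>\<^bsub>L\<^esub> w"
      using arg_cong[OF w(2), of "\<lambda>v. v \<oplus>\<^bsub>L\<^esub> c \<odot>\<^bsub>L\<^esub> x"] ac x NL[OF ac(1)] subspaceD(2)[OF Ps w(1)]
      by (simp add: M.a_ac)
    then show "\<exists>u\<in>adjoin ?D x. \<exists>w\<in>P. y = u \<oplus>\<^bsub>L\<^esub> w"
      using w(1) adjoinI[OF brD[OF x NL[OF ac(1)]] ac(2), of x] by blast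
  qed
  \<comment> \<open>Modular law: in \<open>a = l + c x\<close> both \<open>a\<close> and
    \<open>l\<close> lie in \<open>N\<close>, so \<open>c x\<close> does too, and \<open>x\<close>
    outside \<open>N\<close> forces \<open>c = 0\<close>.\<close>
  have "N \<subseteq> ?D"
  proof
    fix a assume a: "a \<in> N"
    then obtain l c where l: "l \<in> ?D" "c \<in> carrier K" "a = l \<oplus>\<^bsub>L\<^esub> c \<odot>\<^bsub>L\<^esub> x"
      using NL xD by (blast elim: adjoinE)
    then have "c \<odot>\<^bsub>L\<^esub> x \<in> N"
      using a DN x subspace_add_left_cancel[OF Ns, of l "c \<odot>\<^bsub>L\<^esub> x"] by auto
    then have "c = \<zero>\<^bsub>K\<^esub>" using subspace_smult_cancel[OF Ns l(2) _ x] xN by blast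
    then show "a \<in> ?D" using l x subspaceD(2)[OF D] by simp
  qed
  then have DN: "?D = N" using DN by blast

  \<comment> \<open>The nilradical\<close>
  have "nilradical K L = N" unfolding nilradical_def
  proof (rule Greatest_equality)
    show "lie_ideal K L N \<and> lie_nilpotent K (L\<lparr>carrier := N\<rparr>)"
      using N lie_nilpotent_if_ad_nilpotent[OF fin N nil] by simp
    fix I assume I: "lie_ideal K L I \<and> lie_nilpotent K (L\<lparr>carrier := I\<rparr>)"
    interpret I: lie_algebra K "L\<lparr>carrier := I\<rparr>"
      using I by (intro lie_subalgebra_lie_algebra lie_ideal_subalgebra) simp
    obtain k where k: "lower_central K (L\<lparr>carrier := I\<rparr>) k = {\<zero>\<^bsub>L\<^esub>}"
      using I by (auto simp: lie_nilpotent_def)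
    show "I \<le> N"
    proof
      fix y assume y: "y \<in> I"
      then have yL: "y \<in> carrier L" using subspaceD(2)[OF lie_ideal_subspace] I by blast
      then obtain a c where ac: "a \<in> N" "c \<in> carrier K" "y = a \<oplus>\<^bsub>L\<^esub> c \<odot>\<^bsub>L\<^esub> x" using dec by blast
      \<comment> \<open>Otherwise \<open>y\<close> acts on \<open>N\<close> modulo \<open>P\<close>
        as a nonzero scalar, so repeated brackets with \<open>y\<close> starting from
        \<open>z\<close> never enter \<open>P\<close>. They stay in the lower central series of
        \<open>I\<close>, against its nilpotency.\<close>
      have "c = \<zero>\<^bsub>K\<^esub>"
      proof (rule ccontr)
        assume c: "c \<noteq> \<zero>\<^bsub>K\<^esub>"
        have step: "bracket L y v \<in> N - P" if "v \<in> N - P" for v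
        proof -
          have v: "v \<in> N" "v \<in> carrier L" "v \<notin> P" using that NL by auto
          have "\<pi> (bracket L y v) = \<pi> (c \<odot>\<^bsub>L\<^esub> v)"
            using act[OF ac(1) v(1) ac(2)] ac(2,3) v yL by (simp add: \<pi>_bracket \<pi>_smult)
          moreover have "c \<odot>\<^bsub>L\<^esub> v \<notin> P" using subspace_smult_cancel[OF Ps ac(2) c v(2)] v(3) by blast
          ultimately have "bracket L y v \<notin> P"
            using \<pi>_zero[of "c \<odot>\<^bsub>L\<^esub> v"] \<pi>_zero[of "bracket L y v"] ac(2) v(2) yL by simp
          then show ?thesis using lie_ideal_bracket_right[OF N yL v(1)] by simp
        qed
        have zN: "z \<in> N - P" using z by (simp add: N_def)
        have "\<exists>v\<in>N - P. v \<in> lower_central K (L\<lparr>carrier := I\<rparr>) i" for i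
        proof (induction i)
          case 0
          \<comment> \<open>The chain starts with \<open>[y, z]\<close> because \<open>z\<close>
            itself may lie outside \<open>I\<close>.\<close>
          have "bracket L y z \<in> I" using lie_ideal_bracket_left y z(1) I by blast
          then show ?case using step[OF zN] by auto
        next
          case (Suc i)
          then obtain v where v: "v \<in> N - P" "v \<in> lower_central K (L\<lparr>carrier := I\<rparr>) i" by blast
          have "bracket L y v \<in> lower_central K (L\<lparr>carrier := I\<rparr>) (Suc i)"
            using I.bracket_in_lie_product[OF order_refl, of _ y v] y v(2)
              I.subspaceD(1)[OF I.lower_central_subspace[of i]] by simp
          then show ?case using step[OF v(1)] by blast
        qed
        from this[of k] show False using k subspaceD(3)[OF Ps] by auto
      qed
      then show "y \<in> N" using ac x NL[OF ac(1)] by simp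
    qed
  qed
  then show "?D = nilradical K L" using DN by simp

  \<comment> \<open>Codimension one\<close>
  have q: "1 < order K" by (rule order_gt_1[OF finK])
  interpret R: lie_algebra K "lie_quotient L N" by (rule lie_quotient_lie_algebra[OF N])
  have "finite N" by (rule finite_subset[OF subspaceD(1)[OF Ns] fin])
  then have "card N \<noteq> 0" using subspaceD(3)[OF Ns] by auto
  \<comment> \<open>\<open>L = N + K x\<close> with \<open>x\<close> outside \<open>N\<close>, so
    the quotient by \<open>N\<close> has \<open>order K\<close> elements and dimension one.\<close>
  moreover have "card (carrier L) = card N * order K" using card_adjoin[OF Ns x xN] xD DN by simp
  ultimately have "card (carrier (lie_quotient L N)) = order K"
    using card_lie_quotient[OF fin N] by (simp add: mult.commute)
  then have "order K ^ R.dim = order K ^ 1"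
    using R.card_eq_power_dim(1)[OF R.fin_dim_if_finite[OF finite_lie_quotient[OF fin]]] by simp
  then have "R.dim = 1" using q by (simp only: power_inject_exp)
  then show "codimension K L ?D = 1" by (simp add: codimension_def DN)
qed

end

section \<open>From the vertex count to the structure of \<open>L\<close>\<close>

theorem proposition5p5:
  fixes K :: "('a, 'r) ring_scheme"
    and L :: "('a, 'b, 'm) lie_algebra_scheme"
    and q n :: nat
  assumes "lie_algebra K L"
    and "finite (carrier K)"
    and "order K = q"
    and "vectorspace.fin_dim K L"
    and "n = vectorspace.dim K (lie_quotient L (frattini_ideal K L))"
    and "real (card (pverts (comaximal_graph K (lie_quotient L (frattini_ideal K L)))))
           = (\<Sum>k = 1..<n. gaussian_binomial q n k)"
  shows "supersolvable K L \<and>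
    (lie_nilpotent K L \<or>
     lie_derived K L = nilradical K L \<and> codimension K L (lie_derived K L) = 1)"
proof -
  interpret lie_algebra K L by (rule assms(1))
  have fin: "finite (carrier L)" by (rule card_eq_power_dim(2)[OF assms(4,2)])
  define P where "P = frattini_ideal K L"
  have P: "lie_ideal K L P" "P \<subseteq> frattini_subalgebra K L"
    using frattini_ideal[OF fin] by (simp_all add: P_def)
  define Q where "Q = lie_quotient L P"
  interpret Q: lie_algebra K Q unfolding Q_def by (rule lie_quotient_lie_algebra[OF P(1)])
  have finQ: "finite (carrier Q)" unfolding Q_def by (rule finite_lie_quotient[OF fin])
  have cardQ: "card (carrier Q) = order K ^ n"
    using Q.card_eq_power_dim(1)[OF Q.fin_dim_if_finite[OF finQ]] assms(5) by (simp add: Q_def P_def)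
  let ?S = "{W. VectorSpace.subspace K W Q \<and> W \<noteq> {\<zero>\<^bsub>Q\<^esub>} \<and> W \<noteq> carrier Q}"
  note S = Q.card_proper_subspaces[OF assms(2) finQ cardQ]
  have verts: "pverts (comaximal_graph K Q) = {W. lie_subalgebra K Q W \<and> W \<noteq> {\<zero>\<^bsub>Q\<^esub>} \<and> W \<noteq> carrier Q}"
    by (simp add: comaximal_graph_def)
  \<comment> \<open>The vertices are among the proper nonzero subspaces, and by hypothesis there are
    equally many of both.\<close>
  have "pverts (comaximal_graph K Q) = ?S"
  proof (rule card_subset_eq[OF S(1)])
    show "pverts (comaximal_graph K Q) \<subseteq> ?S" unfolding verts by (auto simp: lie_subalgebra_def)
    have "real (card (pverts (comaximal_graph K Q))) = real (card ?S)"
      unfolding S(2) using assms(3,6) by (simp add: Q_def P_def)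
    then show "card (pverts (comaximal_graph K Q)) = card ?S" by (rule of_nat_eq_iff[THEN iffD1])
  qed
  \<comment> \<open>The two subspaces missing from \<open>?S\<close>, zero and \<open>Q\<close>, are
    subalgebras in any case.\<close>
  then have sub: "\<forall>W. VectorSpace.subspace K W Q \<longrightarrow> lie_subalgebra K Q W"
    using Q.lie_subalgebra_zero Q.lie_subalgebra_carrier unfolding verts by blast
  have rcos: "\<exists>y'\<in>carrier L. y = P +>\<^bsub>L\<^esub> y'" if "y \<in> carrier Q" for y
    using that by (auto simp: Q_def lie_quotient_carrier)
  have closed: "P +>\<^bsub>L\<^esub> y \<in> carrier Q" if "y \<in> carrier L" for y
    using that by (simp add: Q_def lie_quotient_carrier)
  note br = lie_quotient_bracket_rcos[OF P(1), folded Q_def]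
    and zero_iff = rcos_eq_zero_iff[OF P(1), folded Q_def]
  from sub show ?thesis
  proof (cases rule: Q.all_subspaces_subalgebras_cases)
    case abelian
    have "bracket L x y \<in> P" if "x \<in> carrier L" "y \<in> carrier L" for x y
      using abelian[OF closed closed, OF that] br[OF that] zero_iff that by simp
    then show ?thesis using nilpotent_if_abelian_mod_frattini[OF assms(2) fin P(2)] by blast
  next
    case (almost_abelian X Z)
    obtain x z where x: "x \<in> carrier L" "X = P +>\<^bsub>L\<^esub> x" and z: "z \<in> carrier L" "Z = P +>\<^bsub>L\<^esub> z"
      using rcos almost_abelian(1,2) by blast
    have decomp: "\<exists>a\<in>carrier L. \<exists>c\<in>carrier K.
        P +>\<^bsub>L\<^esub> bracket L x a = P +>\<^bsub>L\<^esub> a \<and> y = a \<oplus>\<^bsub>L\<^esub> c \<odot>\<^bsub>L\<^esub> x" if y: "y \<in> carrier L" for y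
    proof -
      obtain A c where Ac: "A \<in> carrier Q" "c \<in> carrier K" "bracket Q X A = A"
        "P +>\<^bsub>L\<^esub> y = A \<oplus>\<^bsub>Q\<^esub> c \<odot>\<^bsub>Q\<^esub> X" using almost_abelian(5)[OF closed[OF y]] by blast
      obtain a where a: "a \<in> carrier L" "A = P +>\<^bsub>L\<^esub> a" using rcos Ac(1) by blast
      have "P +>\<^bsub>L\<^esub> y = P +>\<^bsub>L\<^esub> (a \<oplus>\<^bsub>L\<^esub> c \<odot>\<^bsub>L\<^esub> x)"
        using Ac(4) a x Ac(2) lie_quotient_smult_rcos[OF P(1)] lie_quotient_add_rcos[OF P(1)]
        by (simp add: Q_def)
      \<comment> \<open>Lifting the decomposition from \<open>Q\<close> leaves an error
        \<open>w\<close> in \<open>P\<close>. It is absorbed into \<open>a\<close>, whose coset does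
        not change.\<close>
      then obtain w where w: "w \<in> P" "y = (a \<oplus>\<^bsub>L\<^esub> c \<odot>\<^bsub>L\<^esub> x) \<oplus>\<^bsub>L\<^esub> w"
        using rcos_eq_imp_add[OF P(1) y, of "a \<oplus>\<^bsub>L\<^esub> c \<odot>\<^bsub>L\<^esub> x"] a x Ac(2) by auto
      have wL: "w \<in> carrier L" using w subspaceD(2)[OF lie_ideal_subspace[OF P(1)]] by blast
      have aw: "P +>\<^bsub>L\<^esub> (a \<oplus>\<^bsub>L\<^esub> w) = A"
        using lie_quotient_add_rcos[OF P(1) a(1) wL, folded Q_def] zero_iff[OF wL] w(1) a(2) Ac(1)
        by simp
      then have "P +>\<^bsub>L\<^esub> bracket L x (a \<oplus>\<^bsub>L\<^esub> w) = P +>\<^bsub>L\<^esub> (a \<oplus>\<^bsub>L\<^esub> w)"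
        using br[OF x(1), of "a \<oplus>\<^bsub>L\<^esub> w"] a(1) wL x(2) Ac(3) by simp
      moreover have "y = (a \<oplus>\<^bsub>L\<^esub> w) \<oplus>\<^bsub>L\<^esub> c \<odot>\<^bsub>L\<^esub> x"
        using w(2) a(1) wL x(1) Ac(2) by (simp add: M.a_ac)
      ultimately show ?thesis using a(1) wL Ac(2) by blast
    qed
    have comm: "bracket L a b \<in> P"
      if ab: "a \<in> carrier L" "b \<in> carrier L" "P +>\<^bsub>L\<^esub> bracket L x a = P +>\<^bsub>L\<^esub> a"
        "P +>\<^bsub>L\<^esub> bracket L x b = P +>\<^bsub>L\<^esub> b" for a b
      using almost_abelian(6)[OF closed[OF ab(1)] closed[OF ab(2)]] ab x br zero_iff by simp
    have "z \<notin> P" "P +>\<^bsub>L\<^esub> bracket L x z = P +>\<^bsub>L\<^esub> z"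
      using almost_abelian(3,4) x z br[OF x(1) z(1)] zero_iff[OF z(1)] by simp_all
    from almost_abelian_mod_frattini[OF assms(2) fin P x(1) z(1) this decomp comm]
    show ?thesis by (intro conjI disjI2)
  qed
qed

end
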